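(* For every integer $n \geq 4$, $$\mathrm{ex}_{\mathcal{P}}(n,C_4,C_3)= \binom{n-2}{2},$$ and the complete bipartite graph $K_{2,n-2}$ is the unique extremal graph, i.e. it is the only $n$-vertex triangle-free planar graph containing exactly $\binom{n-2}{2}$ copies of $C_4$.
   Context: For graphs $H$ and $F$, $\mathrm{ex}_{\mathcal{P}}(n,H,F)$ denotes the maximum number of copies of $H$ (subgraphs isomorphic to $H$) in an $n$-vertex simple planar graph that contains no subgraph isomorphic to $F$. $C_l$ denotes the cycle of length $l$ (so $C_3$ is the triangle). *)

theory Defs
  imports "HOL-Analysis.Analysis"
begin

datatype 'a ugraph = Graph (verts: "'a set") (edges: "'a set set")

definition simple_graph :: "'a ugraph \<Rightarrow> bool" where
  "simple_graph G \<longleftrightarrow> finite (verts G) \<and> (\<forall>e\<in>edges G. e \<subseteq> verts G \<and> card e = 2)"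

definition is_subgraph :: "'a ugraph \<Rightarrow> 'a ugraph \<Rightarrow> bool" where
  "is_subgraph S G \<longleftrightarrow> simple_graph S \<and> verts S \<subseteq> verts G \<and> edges S \<subseteq> edges G"

definition isomorphic :: "'a ugraph \<Rightarrow> 'b ugraph \<Rightarrow> bool" where
  "isomorphic G H \<longleftrightarrow>
     (\<exists>f. bij_betw f (verts G) (verts H) \<and> edges H = (\<lambda>e. f ` e) ` edges G)"

text \<open>Copies are subgraphs, not necessarily induced, and are counted without labellings.\<close>

definition copies :: "'b ugraph \<Rightarrow> 'a ugraph \<Rightarrow> 'a ugraph set" where
  "copies H G = {S. is_subgraph S G \<and> isomorphic S H}"

definition num_copies :: "'b ugraph \<Rightarrow> 'a ugraph \<Rightarrow> nat" where
  "num_copies H G = card (copies H G)"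

definition free_of :: "'b ugraph \<Rightarrow> 'a ugraph \<Rightarrow> bool" where
  "free_of F G \<longleftrightarrow> copies F G = {}"

text \<open>Meaningful for \<open>l \<ge> 3\<close> only.\<close>

definition cycle_graph :: "nat \<Rightarrow> nat ugraph" where
  "cycle_graph l = Graph {..<l} {{i, (i + 1) mod l} | i. i < l}"

definition complete_bipartite :: "nat \<Rightarrow> nat \<Rightarrow> nat ugraph" where
  "complete_bipartite a b = Graph {..<a + b} {{i, j} | i j. i < a \<and> a \<le> j \<and> j < a + b}"

text \<open>
  A drawing in the plane, identified with the complex numbers: vertices are placed at distinct
  points, and each edge is a simple arc joining its two end points. An arc passes through no
  other vertex, and two different arcs meet only at the images of common end points.
\<close>

definition plane_drawing ::
    "'a ugraph \<Rightarrow> ('a \<Rightarrow> complex) \<Rightarrow> ('a set \<Rightarrow> real \<Rightarrow> complex) \<Rightarrow> bool" where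
  "plane_drawing G p \<gamma> \<longleftrightarrow>
     inj_on p (verts G) \<and>
     (\<forall>e\<in>edges G. arc (\<gamma> e) \<and> {pathstart (\<gamma> e), pathfinish (\<gamma> e)} = p ` e \<and>
        path_image (\<gamma> e) \<inter> p ` verts G = p ` e) \<and>
     (\<forall>e\<in>edges G. \<forall>e'\<in>edges G. e \<noteq> e' \<longrightarrow>
        path_image (\<gamma> e) \<inter> path_image (\<gamma> e') \<subseteq> p ` (e \<inter> e'))"

definition planar :: "'a ugraph \<Rightarrow> bool" where
  "planar G \<longleftrightarrow> (\<exists>p \<gamma>. plane_drawing G p \<gamma>)"

definition planar_free_graphs :: "nat \<Rightarrow> 'b ugraph \<Rightarrow> 'a ugraph set" where
  "planar_free_graphs n F =
     {G. simple_graph G \<and> card (verts G) = n \<and> planar G \<and> free_of F G}"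

text \<open>
  Every finite graph is isomorphic to one with vertices in \<open>nat\<close>, so the maximum may be taken over
  such graphs. The set of values is finite, since the number of copies of \<open>H\<close> is bounded in
  terms of \<open>n\<close>.
\<close>

definition ex_planar :: "nat \<Rightarrow> 'b ugraph \<Rightarrow> 'c ugraph \<Rightarrow> nat" where
  "ex_planar n H F = Max (num_copies H ` (planar_free_graphs n F :: nat ugraph set))"

end

theory Submission
  imports Defs
begin

text \<open>
  The upper bound is proved by induction on the number of vertices. Suppose that two vertices
  \<open>x\<close>, \<open>y\<close> have three common neighbours \<open>a\<close>, \<open>b\<close>, \<open>c\<close>. In a plane drawing a face of the resulting
  theta curve cannot touch all of \<open>a\<close>, \<open>b\<close>, \<open>c\<close>. So any further vertex is separated from one of
  them, say from \<open>c\<close>, by the 4-cycle \<open>x a y b\<close>. If the two sides have \<open>p\<close> and \<open>q\<close> vertices, a 4-cycle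
  meeting both sides is determined by its vertices on the two sides, so that there are at
  most \<open>p q\<close> of these; the induction hypothesis for the two halves adds up to the bound
  exactly, and equality forces \<open>x\<close> and \<open>y\<close> to be joined to everything else.

  If on the other hand no two vertices have three common neighbours, then each non-adjacent pair is
  a diagonal of at most one 4-cycle, and counting the diagonals suffices.
\<close>

section \<open>Theta curves in the plane\<close>

text \<open>
  The side of \<open>f \<union> g\<close> not containing \<open>X\<close> misses \<open>h\<close> as well, because \<open>X\<close> together with
  the open arc of \<open>h\<close> is connected through the accessible point \<open>q\<close>.
\<close>

lemma theta_far_side:
  fixes f g h :: "real \<Rightarrow> complex"
  assumes "arc f" "arc g" "arc h"
    and ends: "pathstart f = s" "pathfinish f = t" "pathstart g = s" "pathfinish g = t"
      "pathstart h = s" "pathfinish h = t"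
    and int: "path_image f \<inter> path_image g \<subseteq> {s, t}" "path_image f \<inter> path_image h \<subseteq> {s, t}"
      "path_image g \<inter> path_image h \<subseteq> {s, t}"
    and X: "connected X" "X \<inter> path_image f = {}" "X \<inter> path_image g = {}" "X \<inter> path_image h = {}" "u \<in> X"
    and q: "q \<in> closure X" "q \<in> path_image h - {s, t}"
  obtains V W where "open V" "open W" "connected V" "connected W" "V \<noteq> {}" "u \<in> W" "V \<inter> W = {}"
    "V \<union> W = - (path_image f \<union> path_image g)" "frontier V = path_image f \<union> path_image g"
    "V \<inter> path_image h = {}"
proof -
  let ?c = "f +++ reversepath g"
  have im: "path_image ?c = path_image f \<union> path_image g"
    using ends by (simp add: path_image_join)
  have "simple_path ?c"
    using assms by (intro simple_path_join_loop) (auto simp: arc_reversepath)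
  moreover have "pathfinish ?c = pathstart ?c"
    using ends by simp
  ultimately obtain I J where IJ: "I \<noteq> {}" "open I" "connected I" "J \<noteq> {}" "open J" "connected J"
    "I \<inter> J = {}" "I \<union> J = - (path_image f \<union> path_image g)"
    "frontier I = path_image f \<union> path_image g" "frontier J = path_image f \<union> path_image g"
    by (metis Jordan_curve im)
  have "connected (insert q X)"
    using connected_intermediate_closure[OF X(1), of "insert q X"] q(1) closure_subset by blast
  moreover have "connected (path_image h - {s, t})"
    using connected_simple_path_endless[OF arc_imp_simple_path[OF \<open>arc h\<close>]] ends by simp
  ultimately have con: "connected (insert q X \<union> (path_image h - {s, t}))"
    using q by (intro connected_Un) auto
  let ?K = "insert q X \<union> (path_image h - {s, t})"
  have K: "?K \<subseteq> - (path_image f \<union> path_image g)" "u \<in> ?K"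
    using X q int by auto
  have st: "s \<in> path_image f" "t \<in> path_image f"
    using pathstart_in_path_image[of f] pathfinish_in_path_image[of f] ends by simp_all
  have one_side: "?K \<inter> V = {}"
    if "open V" "open W" "V \<inter> W = {}" "V \<union> W = - (path_image f \<union> path_image g)" "u \<in> W" for V W
    using connectedD[OF con that(1,2)] that K by blast
  have "u \<in> I \<or> u \<in> J"
    using IJ(8) K by blast
  then show thesis
  proof
    assume "u \<in> I"
    then have "?K \<inter> J = {}"
      using one_side[of J I] IJ by blast
    then have "J \<inter> path_image h = {}"
      using IJ(8) st by blast
    then show thesis
      using that[of J I] IJ \<open>u \<in> I\<close> by blast
  next
    assume "u \<in> J"
    then have "?K \<inter> I = {}"
      using one_side[of I J] IJ by blast
    then have "I \<inter> path_image h = {}"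
      using IJ(8) st by blast
    then show thesis
      using that[of I J] IJ \<open>u \<in> J\<close> by blast
  qed
qed

text \<open>
  No face of a theta curve touches all three of its open arcs. Otherwise the far sides of the three
  Jordan curves are pairwise disjoint, so a point \<open>v\<close> of the first one lies on the same side as \<open>u\<close>
  of the other two curves. These meet in the connected set \<open>h\<close>, and Janiszewski's theorem
  connects \<open>u\<close> to \<open>v\<close> off the whole theta curve.
\<close>

lemma theta_face:
  fixes f g h :: "real \<Rightarrow> complex"
  assumes arcs: "arc f" "arc g" "arc h"
    and ends: "pathstart f = s" "pathfinish f = t" "pathstart g = s" "pathfinish g = t"
      "pathstart h = s" "pathfinish h = t"
    and int: "path_image f \<inter> path_image g \<subseteq> {s, t}" "path_image f \<inter> path_image h \<subseteq> {s, t}"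
      "path_image g \<inter> path_image h \<subseteq> {s, t}"
    and X: "connected X" "X \<inter> (path_image f \<union> path_image g \<union> path_image h) = {}"
    and q: "closure X \<inter> (path_image f - {s, t}) \<noteq> {}" "closure X \<inter> (path_image g - {s, t}) \<noteq> {}"
      "closure X \<inter> (path_image h - {s, t}) \<noteq> {}"
  shows False
proof -
  obtain u where u: "u \<in> X"
    using q(1) by fastforce
  let ?F = "path_image f" and ?G = "path_image g" and ?H = "path_image h"
  have disj: "X \<inter> ?F = {}" "X \<inter> ?G = {}" "X \<inter> ?H = {}"
    using X(2) by blast+
  have int': "?G \<inter> ?F \<subseteq> {s, t}" "?H \<inter> ?F \<subseteq> {s, t}" "?H \<inter> ?G \<subseteq> {s, t}"
    using int by blast+
  obtain q1 q2 q3 where q': "q1 \<in> closure X" "q1 \<in> ?F - {s, t}" "q2 \<in> closure X" "q2 \<in> ?G - {s, t}"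
      "q3 \<in> closure X" "q3 \<in> ?H - {s, t}"
    using q by blast
  obtain V1 W1 where 1: "open V1" "open W1" "connected V1" "connected W1" "V1 \<noteq> {}" "u \<in> W1"
      "V1 \<inter> W1 = {}" "V1 \<union> W1 = - (?F \<union> ?G)" "frontier V1 = ?F \<union> ?G" "V1 \<inter> ?H = {}"
    using theta_far_side[OF arcs ends int X(1) disj u q'(5,6)] .
  obtain V2 W2 where 2: "open V2" "open W2" "connected V2" "connected W2" "V2 \<noteq> {}" "u \<in> W2"
      "V2 \<inter> W2 = {}" "V2 \<union> W2 = - (?G \<union> ?H)" "frontier V2 = ?G \<union> ?H" "V2 \<inter> ?F = {}"
    using theta_far_side[OF arcs(2,3,1) ends(3-6,1,2) int(3) int'(1,2) X(1) disj(2,3,1) u q'(1,2)] .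
  obtain V3 W3 where 3: "open V3" "open W3" "connected V3" "connected W3" "V3 \<noteq> {}" "u \<in> W3"
      "V3 \<inter> W3 = {}" "V3 \<union> W3 = - (?F \<union> ?H)" "frontier V3 = ?F \<union> ?H" "V3 \<inter> ?G = {}"
    using theta_far_side[OF arcs(1,3,2) ends(1,2,5,6,3,4) int(2,1) int'(3) X(1) disj(1,3,2) u q'(3,4)] .
  have sub: "V \<subseteq> V'" if "connected V" "open V'" "open W'" "V' \<inter> W' = {}" "V \<subseteq> V' \<union> W'" "V \<inter> V' \<noteq> {}"
    for V V' W' :: "complex set"
    using connectedD[OF that(1,2,3)] that by blast
  \<comment> \<open>Each of \<open>q1\<close>, \<open>q2\<close>, \<open>q3\<close> lies on only one
    of the three arcs, so the frontiers, and with them the far sides, are different.\<close>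
  have "?F \<union> ?G \<noteq> ?G \<union> ?H" "?F \<union> ?G \<noteq> ?F \<union> ?H"
    using q' int by blast+
  then have ne: "V1 \<noteq> V2" "V1 \<noteq> V3"
    by (metis 1(9) 2(9), metis 1(9) 3(9))
  \<comment> \<open>Each far side misses the third arc, hence lies off the other Jordan curve, and
    being connected it lies on one side of it. If two far sides met, each would contain the
    other.\<close>
  have "V1 \<inter> V2 = {}"
  proof (rule ccontr)
    assume "V1 \<inter> V2 \<noteq> {}"
    moreover have "V1 \<subseteq> V2 \<union> W2" "V2 \<subseteq> V1 \<union> W1"
      using 1(8,10) 2(8,10) by blast+
    ultimately have "V1 = V2"
      using sub[OF 1(3) 2(1,2,7)] sub[OF 2(3) 1(1,2,7)] by (metis Int_commute subset_antisym)
    then show False using ne by blast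
  qed
  moreover have "V1 \<inter> V3 = {}"
  proof (rule ccontr)
    assume "V1 \<inter> V3 \<noteq> {}"
    moreover have "V1 \<subseteq> V3 \<union> W3" "V3 \<subseteq> V1 \<union> W1"
      using 1(8,10) 3(8,10) by blast+
    ultimately have "V1 = V3"
      using sub[OF 1(3) 3(1,2,7)] sub[OF 3(3) 1(1,2,7)] by (metis Int_commute subset_antisym)
    then show False using ne by blast
  qed
  moreover obtain v where v: "v \<in> V1"
    using 1(5) by blast
  ultimately have vW: "v \<in> W2" "v \<in> W3"
    using 1(8,10) 2(8) 3(8) by blast+
  have st: "s \<in> ?H" "t \<in> ?H"
    using pathstart_in_path_image[of h] pathfinish_in_path_image[of h] ends by simp_all
  have "connected_component (- ((?G \<union> ?H) \<union> (?F \<union> ?H))) v u"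
  proof (rule Janiszewski)
    have "(?G \<union> ?H) \<inter> (?F \<union> ?H) = ?H"
      using int st by blast
    then show "connected ((?G \<union> ?H) \<inter> (?F \<union> ?H))"
      by (simp add: connected_arc_image arcs)
    show "connected_component (- (?G \<union> ?H)) v u"
      unfolding connected_component_def using 2(4,6,8) vW by blast
    show "connected_component (- (?F \<union> ?H)) v u"
      unfolding connected_component_def using 3(4,6,8) vW by blast
  qed (auto simp: compact_Un compact_arc_image arcs closed_Un compact_imp_closed)
  \<comment> \<open>\<open>K\<close> would join the two sides of the Jordan curve formed by
    \<open>f\<close> and \<open>g\<close>.\<close>
  then obtain K where "connected K" "K \<subseteq> V1 \<union> W1" "v \<in> K" "u \<in> K"
    unfolding connected_component_def 1(8) by blast
  then show False
    using connectedD[of K V1 W1] 1(1,2,6,7) v by blast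
qed

text \<open>
  The only consequence of planarity that the counting argument needs: in a drawing, \<open>D\<close> consists of
  the vertices in the face of the copy of \<open>K\<^bsub>2,3\<^esub>\<close> containing \<open>w\<close>.
\<close>

definition theta_separation :: "'a set \<Rightarrow> 'a set set \<Rightarrow> bool" where
  "theta_separation V E \<longleftrightarrow>
     (\<forall>x y a b c w. distinct [x, y, a, b, c, w] \<and> {x, y, a, b, c, w} \<subseteq> V \<and>
        (\<forall>u\<in>{a, b, c}. {x, u} \<in> E \<and> {y, u} \<in> E) \<longrightarrow>
        (\<exists>D \<subseteq> V - {x, y, a, b, c}. w \<in> D \<and>
           (\<forall>d\<in>D. \<forall>v\<in>V - {x, y, a, b, c} - D. {d, v} \<notin> E) \<and>
           (\<exists>u\<in>{a, b, c}. \<forall>d\<in>D. {d, u} \<notin> E)))"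

text \<open>The induction shrinks the vertex set while \<open>E\<close> stays fixed; a witness
  \<open>D\<close> is cut down to \<open>D \<inter> V'\<close>.\<close>

lemma theta_separation_mono:
  assumes "theta_separation V E" "V' \<subseteq> V"
  shows "theta_separation V' E"
  unfolding theta_separation_def
proof (intro allI impI)
  fix x y a b c w
  assume *: "distinct [x, y, a, b, c, w] \<and> {x, y, a, b, c, w} \<subseteq> V' \<and>
    (\<forall>u\<in>{a, b, c}. {x, u} \<in> E \<and> {y, u} \<in> E)"
  then have "distinct [x, y, a, b, c, w] \<and> {x, y, a, b, c, w} \<subseteq> V \<and>
    (\<forall>u\<in>{a, b, c}. {x, u} \<in> E \<and> {y, u} \<in> E)"
    using assms(2) by blast
  then obtain D where D: "D \<subseteq> V - {x, y, a, b, c}" "w \<in> D"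
    "\<forall>d\<in>D. \<forall>v\<in>V - {x, y, a, b, c} - D. {d, v} \<notin> E" "\<exists>u\<in>{a, b, c}. \<forall>d\<in>D. {d, u} \<notin> E"
    using assms(1)[unfolded theta_separation_def, rule_format, of x y a b c w] by metis
  show "\<exists>D \<subseteq> V' - {x, y, a, b, c}. w \<in> D \<and>
      (\<forall>d\<in>D. \<forall>v\<in>V' - {x, y, a, b, c} - D. {d, v} \<notin> E) \<and>
      (\<exists>u\<in>{a, b, c}. \<forall>d\<in>D. {d, u} \<notin> E)"
  proof (intro exI[of _ "D \<inter> V'"] conjI)
    show "w \<in> D \<inter> V'" using D(2) * by simp
    show "\<forall>d\<in>D \<inter> V'. \<forall>v\<in>V' - {x, y, a, b, c} - D \<inter> V'. {d, v} \<notin> E"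
      using D(3) assms(2) by blast
    show "\<exists>u\<in>{a, b, c}. \<forall>d\<in>D \<inter> V'. {d, u} \<notin> E"
      using D(4) by blast
  qed (use D(1) in blast)
qed

section \<open>From plane drawings to separation by theta curves\<close>

text \<open>A drawing prescribes only the unordered pair of end points of an edge, so the arc may
  have to be reversed before edges can be concatenated into paths.\<close>

lemma plane_drawing_edge_arc:
  assumes "plane_drawing G p \<gamma>" "{u, v} \<in> edges G"
  obtains g where "arc g" "pathstart g = p u" "pathfinish g = p v"
    "path_image g = path_image (\<gamma> {u, v})"
proof -
  let ?g = "\<gamma> {u, v}"
  have g: "arc ?g" "{pathstart ?g, pathfinish ?g} = {p u, p v}"
    using assms by (auto simp: plane_drawing_def)
  then consider "pathstart ?g = p u" "pathfinish ?g = p v" | "pathstart ?g = p v" "pathfinish ?g = p u"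
    by (auto simp: doubleton_eq_iff)
  then show thesis
  proof cases
    case 1
    then show ?thesis using that g(1) by blast
  next
    case 2
    then show ?thesis using that[of "reversepath ?g"] g(1) by (simp add: arc_reversepath)
  qed
qed

text \<open>Meant for an edge from a vertex inside a face to a vertex of its boundary: the half-open
  arc stays in the face, yet accumulates at the boundary vertex.\<close>

lemma arc_minus_finish:
  fixes g :: "real \<Rightarrow> complex"
  assumes "arc g"
  obtains S where "connected S" "pathstart g \<in> S" "pathfinish g \<in> closure S"
    "S = path_image g - {pathfinish g}"
proof -
  let ?S = "g ` {0..<1}"
  have cont: "continuous_on {0..1} g" and inj: "inj_on g {0..1}"
    using assms by (auto simp: arc_def path_def)
  have "connected ?S"
    using cont by (intro connected_continuous_image) (auto intro: continuous_on_subset)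
  moreover have "pathstart g \<in> ?S"
    by (simp add: pathstart_def)
  moreover have "g ` closure {0..<1} \<subseteq> closure ?S"
    using cont by (intro image_closure_subset) (auto simp: closure_subset)
  then have "pathfinish g \<in> closure ?S"
    by (auto simp: pathfinish_def)
  moreover have "?S = path_image g - {pathfinish g}"
  proof -
    have "{0..1::real} - {1} = {0..<1}" "{0..<1::real} \<subseteq> {0..1}" by auto
    then show ?thesis
      using inj_on_image_set_diff[OF inj, of "{0..1}" "{1}"]
      by (simp add: path_image_def pathfinish_def)
  qed
  ultimately show thesis using that by blast
qed

text \<open>Edges between vertices off the theta curve avoid it and so stay within one face. An edge
  from the face to \<open>a\<close>, \<open>b\<close> or \<open>c\<close> puts that vertex into the
  closure of the face, and by \<open>theta_face\<close> this cannot happen for all three.\<close>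

lemma plane_drawing_theta_separation:
  fixes G :: "'a ugraph"
  assumes dr: "plane_drawing G p \<gamma>" and simple: "simple_graph G"
  shows "theta_separation (verts G) (edges G)"
  unfolding theta_separation_def
proof (intro allI impI)
  fix x y a b c w :: 'a
  let ?V = "verts G" and ?E = "edges G" and ?N = "{x, y, a, b, c}"
  define I where "I e = path_image (\<gamma> e)" for e
  assume "distinct [x, y, a, b, c, w] \<and> {x, y, a, b, c, w} \<subseteq> ?V \<and>
    (\<forall>u\<in>{a, b, c}. {x, u} \<in> ?E \<and> {y, u} \<in> ?E)"
  then have dist: "distinct [x, y, a, b, c, w]" and V: "{x, y, a, b, c, w} \<subseteq> ?V"
    and E: "\<And>u. u \<in> {a, b, c} \<Longrightarrow> {x, u} \<in> ?E \<and> {y, u} \<in> ?E"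
    by blast+
  have inj: "inj_on p ?V" and on_V: "\<And>e. e \<in> ?E \<Longrightarrow> I e \<inter> p ` ?V = p ` e"
    and meet: "\<And>e e'. e \<in> ?E \<Longrightarrow> e' \<in> ?E \<Longrightarrow> e \<noteq> e' \<Longrightarrow> I e \<inter> I e' \<subseteq> p ` (e \<inter> e')"
    using dr unfolding plane_drawing_def I_def by blast+
  have edge_V: "u \<in> ?V" "v \<in> ?V" if "{u, v} \<in> ?E" for u v
    using that simple by (auto simp: simple_graph_def)
  have p_mem: "p v \<in> I e \<longleftrightarrow> v \<in> e" if "e \<in> ?E" "v \<in> ?V" for e v
  proof -
    have "e \<subseteq> ?V" using that simple by (auto simp: simple_graph_def)
    then show ?thesis
      using on_V[OF that(1)] inj_on_image_mem_iff[OF inj that(2)] that(2) by blast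
  qed
  \<comment> \<open>The path from \<open>x\<close> to \<open>y\<close> through the middle vertex
    \<open>u\<close>; the three of them form the theta curve \<open>T\<close>.\<close>
  define P where "P u = I {x, u} \<union> I {y, u}" for u
  have arcP: "\<exists>f. arc f \<and> pathstart f = p x \<and> pathfinish f = p y \<and> path_image f = P u"
    if u: "u \<in> {a, b, c}" for u
  proof -
    obtain g where g: "arc g" "pathstart g = p x" "pathfinish g = p u" "path_image g = I {x, u}"
      using plane_drawing_edge_arc[OF dr, of x u] E[OF u] unfolding I_def by metis
    obtain h where h: "arc h" "pathstart h = p y" "pathfinish h = p u" "path_image h = I {y, u}"
      using plane_drawing_edge_arc[OF dr, of y u] E[OF u] unfolding I_def by metis
    have ne: "{x, u} \<noteq> {y, u}" "{x, u} \<inter> {y, u} = {u}"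
      using dist u by (auto simp: doubleton_eq_iff)
    have "I {x, u} \<inter> I {y, u} \<subseteq> {p u}"
      using meet[of "{x, u}" "{y, u}"] E[OF u] ne by auto
    then have "arc (g +++ reversepath h)"
      using g h by (intro arc_join) (auto simp: arc_reversepath)
    then show ?thesis
      using g h by (intro exI[of _ "g +++ reversepath h"]) (simp add: path_image_join P_def)
  qed
  have meetP: "P u \<inter> P v \<subseteq> {p x, p y}" if u: "u \<in> {a, b, c}" and v: "v \<in> {a, b, c}" and "u \<noteq> v" for u v
  proof -
    have nx: "x \<noteq> u" "y \<noteq> u" "x \<noteq> v" "y \<noteq> v" "x \<noteq> y"
      using dist u v by auto
    have "I {s, u} \<inter> I {t, v} \<subseteq> {p x, p y}" if "s \<in> {x, y}" "t \<in> {x, y}" for s t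
    proof -
      have "{s, u} \<noteq> {t, v}" "{s, u} \<inter> {t, v} \<subseteq> {x, y}"
        using nx that \<open>u \<noteq> v\<close> by (auto simp: doubleton_eq_iff)
      moreover have "{s, u} \<in> ?E" "{t, v} \<in> ?E"
        using that E[OF u] E[OF v] by auto
      ultimately show ?thesis
        using meet[of "{s, u}" "{t, v}"] by blast
    qed
    then show ?thesis
      unfolding P_def by blast
  qed
  define T where "T = P a \<union> P b \<union> P c"
  have T_iff: "z \<in> T \<longleftrightarrow> (\<exists>u\<in>{a, b, c}. \<exists>s\<in>{x, y}. z \<in> I {s, u})" for z
    by (auto simp: T_def P_def)
  have V_T: "p v \<notin> T" if "v \<in> ?V - ?N" for v
    unfolding T_iff using that p_mem[of _ v] E by auto
  define F where "F = connected_component_set (- T) (p w)"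
  have F: "connected F" "F \<inter> T = {}"
    using connected_component_subset[of "- T" "p w"] by (auto simp: F_def)
  have absorb: "S \<subseteq> F" if "connected S" "S \<inter> T = {}" "z \<in> S" "z \<in> F" for S z
    using connected_component_maximal[of z S "- T"] that connected_component_eq[of z "- T" "p w"]
    unfolding F_def by blast
  define D where "D = {v \<in> ?V - ?N. p v \<in> F}"
  have D_N: "d \<in> ?V - ?N" "p d \<in> F" if "d \<in> D" for d
    using that by (auto simp: D_def)
  have w: "w \<in> ?V - ?N"
    using V dist by auto
  then have "w \<in> D"
    using V_T[of w] by (simp add: D_def F_def)
  \<comment> \<open>An edge at a vertex \<open>d\<close> off the theta curve can touch the curve
    only at its other end, and only if that end is one of the five vertices.\<close>
  have meetT: "I {d, v} \<inter> T \<subseteq> p ` ({v} \<inter> ?N)" if "{d, v} \<in> ?E" "d \<in> ?V - ?N" for d v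
  proof
    fix z assume z: "z \<in> I {d, v} \<inter> T"
    then obtain u s where us: "u \<in> {a, b, c}" "s \<in> {x, y}" "z \<in> I {s, u}"
      by (auto simp: T_iff)
    have su: "{s, u} \<in> ?E"
      using E[OF us(1)] us(2) by auto
    have "d \<notin> {s, u}" "{s, u} \<subseteq> ?N"
      using us(1,2) that(2) by auto
    moreover from this have "{d, v} \<noteq> {s, u}"
      by auto
    then have "z \<in> p ` ({d, v} \<inter> {s, u})"
      using meet[OF that(1) su] z us(3) by auto
    ultimately show "z \<in> p ` ({v} \<inter> ?N)"
      by (elim imageE) auto
  qed
  have "\<forall>d\<in>D. \<forall>v\<in>?V - ?N - D. {d, v} \<notin> ?E"
  proof (intro ballI notI)
    fix d v assume d: "d \<in> D" and v: "v \<in> ?V - ?N - D" and e: "{d, v} \<in> ?E"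
    have "I {d, v} \<inter> T = {}"
      using meetT[OF e] D_N[OF d] v by blast
    moreover have "connected (I {d, v})"
      using plane_drawing_edge_arc[OF dr e] unfolding I_def by (metis connected_arc_image)
    moreover have "p d \<in> I {d, v}" "p v \<in> I {d, v}"
      using p_mem[OF e] edge_V[OF e] by auto
    ultimately have "p v \<in> F"
      using absorb[of "I {d, v}" "p d"] D_N[OF d] by blast
    then show False
      using v by (auto simp: D_def)
  qed
  moreover have "\<exists>u\<in>{a, b, c}. p u \<notin> closure F"
  proof (rule ccontr)
    assume "\<not> ?thesis"
    then have cl: "p a \<in> closure F" "p b \<in> closure F" "p c \<in> closure F"
      by auto
    obtain fa fb fc where
      fa: "arc fa" "pathstart fa = p x" "pathfinish fa = p y" "path_image fa = P a" and
      fb: "arc fb" "pathstart fb = p x" "pathfinish fb = p y" "path_image fb = P b" and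
      fc: "arc fc" "pathstart fc = p x" "pathfinish fc = p y" "path_image fc = P c"
      using arcP[of a] arcP[of b] arcP[of c] by auto
    have mem: "p u \<in> P u - {p x, p y}" if "u \<in> {a, b, c}" for u
    proof -
      have "u \<in> ?V" "u \<noteq> x" "u \<noteq> y" "x \<in> ?V" "y \<in> ?V"
        using that V dist by auto
      then show ?thesis
        using p_mem[of "{x, u}" u] E[OF that] inj by (auto simp: P_def inj_on_def)
    qed
    have "closure F \<inter> (P a - {p x, p y}) \<noteq> {}" "closure F \<inter> (P b - {p x, p y}) \<noteq> {}"
      "closure F \<inter> (P c - {p x, p y}) \<noteq> {}"
      using cl mem[of a] mem[of b] mem[of c] by auto
    moreover have "P a \<inter> P b \<subseteq> {p x, p y}" "P a \<inter> P c \<subseteq> {p x, p y}" "P b \<inter> P c \<subseteq> {p x, p y}"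
      using meetP[of a b] meetP[of a c] meetP[of b c] dist by auto
    ultimately show False
      using theta_face[OF fa(1) fb(1) fc(1) fa(2,3) fb(2,3) fc(2,3), of F] F
      unfolding fa(4) fb(4) fc(4) T_def by blast
  qed
  then obtain u where u: "u \<in> {a, b, c}" "p u \<notin> closure F" by blast
  have "\<forall>d\<in>D. {d, u} \<notin> ?E"
  proof (intro ballI notI)
    fix d assume d: "d \<in> D" and e: "{d, u} \<in> ?E"
    obtain g where g: "arc g" "pathstart g = p d" "pathfinish g = p u" "path_image g = I {d, u}"
      using plane_drawing_edge_arc[OF dr e] unfolding I_def by metis
    obtain S where S: "connected S" "p d \<in> S" "p u \<in> closure S" "S = I {d, u} - {p u}"
      using arc_minus_finish[OF g(1)] unfolding g by metis
    have "S \<inter> T = {}"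
      using meetT[OF e] D_N[OF d] S(4) by blast
    then have "S \<subseteq> F"
      using absorb[OF S(1) _ S(2)] D_N[OF d] by blast
    then show False
      using S(3) u(2) closure_mono by blast
  qed
  ultimately show "\<exists>D \<subseteq> ?V - ?N. w \<in> D \<and> (\<forall>d\<in>D. \<forall>v\<in>?V - ?N - D. {d, v} \<notin> ?E) \<and>
      (\<exists>u\<in>{a, b, c}. \<forall>d\<in>D. {d, u} \<notin> ?E)"
    using \<open>w \<in> D\<close> u(1) D_N(1) by (intro exI[of _ D] conjI) blast+
qed

section \<open>Counting 4-cycles in triangle-free graphs\<close>

lemma double_choose_two: "2 * ((n + 2) choose 2) = (n + 2) * (n + 1)" for n :: nat
  by (simp add: choose_two)

text \<open>The bookkeeping for cutting along a 4-cycle with \<open>m\<close> and \<open>n\<close>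
  vertices on its sides: the halves have \<open>m + 4\<close> and \<open>n + 4\<close> vertices, and
  the \<open>+ 1\<close> stands for the separating cycle, which is counted in both.\<close>

lemma choose_two_split:
  fixes m n :: nat
  shows "((m + n + 2) choose 2) + 1 = ((m + 2) choose 2) + ((n + 2) choose 2) + m * n"
proof -
  have "2 * (((m + n + 2) choose 2) + 1) = 2 * (((m + 2) choose 2) + ((n + 2) choose 2) + m * n)"
    by (simp only: distrib_left double_choose_two) (simp add: algebra_simps)
  then show ?thesis by (simp only: mult_left_cancel)
qed

text \<open>Here \<open>q\<close> counts 4-cycles and \<open>e\<close> counts edges on
  \<open>k + 4\<close> vertices. For \<open>k \<ge> 4\<close> the quadratic inequality is already
  strict; for the four smaller values the lower bounds on \<open>e\<close> exclude larger
  \<open>q\<close> and leave equality only at \<open>k = 0\<close>.\<close>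

lemma choose_two_sum_bound:
  fixes q e k :: nat
  assumes "2 * q + e \<le> (k + 4) choose 2" "1 \<le> q \<Longrightarrow> 4 \<le> e" "2 \<le> q \<Longrightarrow> 5 \<le> e"
  shows "q \<le> (k + 2) choose 2 \<and> (q = (k + 2) choose 2 \<longrightarrow> k = 0)"
proof -
  have "k + 2 + 2 = k + 4" "k + 2 + 1 = k + 3"
    by simp_all
  then have "2 * ((k + 4) choose 2) = (k + 4) * (k + 3)"
    using double_choose_two[of "k + 2"] by presburger
  then have 1: "4 * q + 2 * e \<le> (k + 4) * (k + 3)"
    using assms(1) by linarith
  define M where "M = (k + 2) choose 2"
  have 2: "2 * M = (k + 2) * (k + 1)"
    unfolding M_def by (rule double_choose_two)
  have e: "q < 1 \<or> 4 \<le> e" "q < 2 \<or> 5 \<le> e"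
    using assms(2,3) by linarith+
  have "q \<le> M \<and> (q = M \<longrightarrow> k = 0)"
  proof (cases "k \<ge> 4")
    case True
    then obtain j where "k = j + 4"
      by (metis add.commute le_Suc_ex)
    then have "2 * q < 2 * M"
      using 1 2 by (simp add: algebra_simps)
    then show ?thesis by linarith
  next
    case False
    then consider "k = 0" | "k = 1" | "k = 2" | "k = 3" by linarith
    then have "4 * q + 2 * e \<le> 12 \<and> M = 1 \<and> k = 0 \<or> 4 * q + 2 * e \<le> 20 \<and> M = 3 \<or>
        4 * q + 2 * e \<le> 30 \<and> M = 6 \<or> 4 * q + 2 * e \<le> 42 \<and> M = 10"
      using 1 2 by cases auto
    then show ?thesis
      using e by linarith
  qed
  then show ?thesis unfolding M_def .
qed

section \<open>4-cycles as vertex sets\<close>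

text \<open>The vertex set is left as a parameter because the induction varies it. With three equal
  vertices the assumption also excludes singleton edges.\<close>

locale triangle_free_edges =
  fixes E :: "'a set set"
  assumes no_triangle: "{u, v} \<in> E \<Longrightarrow> {v, w} \<in> E \<Longrightarrow> {u, w} \<notin> E"
begin

definition adj :: "'a \<Rightarrow> 'a \<Rightarrow> bool" where
  "adj u v \<longleftrightarrow> {u, v} \<in> E"

lemma adj_sym: "adj u v \<Longrightarrow> adj v u"
  by (simp add: adj_def insert_commute)

lemma adj_irrefl: "\<not> adj u u"
  using no_triangle[of u u u] by (auto simp: adj_def)

lemma adj_triangle: "adj u v \<Longrightarrow> adj v w \<Longrightarrow> \<not> adj u w"
  using no_triangle[of u v w] by (auto simp: adj_def)

text \<open>The diagonals of a 4-cycle are not edges when there are no triangles, so four vertices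
  span at most one 4-cycle and vertex sets can stand for cycles.\<close>

definition c4_sets :: "'a set \<Rightarrow> 'a set set" where
  "c4_sets V = {S. S \<subseteq> V \<and> (\<exists>x a y b. S = {x, a, y, b} \<and> x \<noteq> y \<and> a \<noteq> b \<and>
     adj x a \<and> adj x b \<and> adj y a \<and> adj y b)}"

definition dominating_pair :: "'a set \<Rightarrow> 'a \<Rightarrow> 'a \<Rightarrow> bool" where
  "dominating_pair V x y \<longleftrightarrow> x \<in> V \<and> y \<in> V \<and> x \<noteq> y \<and> (\<forall>v\<in>V - {x, y}. adj x v \<and> adj y v)"

lemma finite_c4_sets: "finite V \<Longrightarrow> finite (c4_sets V)"
  by (rule finite_subset[of _ "Pow V"]) (auto simp: c4_sets_def)

lemma c4_setsI:
  assumes "{x, a, y, b} \<subseteq> V" "x \<noteq> y" "a \<noteq> b" "adj x a" "adj x b" "adj y a" "adj y b"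
  shows "{x, a, y, b} \<in> c4_sets V"
  unfolding c4_sets_def using assms by blast

lemma c4_setsE:
  assumes "S \<in> c4_sets V"
  obtains x a y b where "S = {x, a, y, b}" "S \<subseteq> V" "x \<noteq> y" "a \<noteq> b"
    "adj x a" "adj x b" "adj y a" "adj y b" "distinct [x, a, y, b]" "\<not> adj x y" "\<not> adj a b"
proof -
  obtain x a y b where *: "S = {x, a, y, b}" "S \<subseteq> V" "x \<noteq> y" "a \<noteq> b"
    "adj x a" "adj x b" "adj y a" "adj y b"
    using assms unfolding c4_sets_def by blast
  have "x \<noteq> a" "x \<noteq> b" "y \<noteq> a" "y \<noteq> b"
    using * adj_irrefl by metis+
  then have "distinct [x, a, y, b]"
    using *(3,4) by auto
  moreover have "\<not> adj x y" "\<not> adj a b"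
    using * adj_sym adj_triangle by metis+
  ultimately show thesis using that * by blast
qed

text \<open>The diagonals are the only non-adjacent pairs of a 4-cycle, so any such pair may be
  taken as \<open>{u, w}\<close> with the other diagonal as its two common neighbours. Both counting
  arguments use this normal form.\<close>

lemma c4_sets_nonadjacent:
  assumes "S \<in> c4_sets V" "u \<in> S" "w \<in> S" "u \<noteq> w" "\<not> adj u w"
  obtains s t where "S = {u, s, w, t}" "s \<noteq> t" "adj u s" "adj u t" "adj w s" "adj w t"
proof -
  obtain x a y b where *: "S = {x, a, y, b}" "x \<noteq> y" "a \<noteq> b" "adj x a" "adj x b" "adj y a" "adj y b"
    using c4_setsE[OF assms(1)] by metis
  have sym: "adj a x" "adj b x" "adj a y" "adj b y"
    using * adj_sym by blast+
  have "{u, w} = {x, y} \<or> {u, w} = {a, b}"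
    using assms(2-5) * sym by auto
  then consider "u = x" "w = y" | "u = y" "w = x" | "u = a" "w = b" | "u = b" "w = a"
    by (auto simp: doubleton_eq_iff)
  then show thesis
    using that[of a b] that[of x y] * sym by cases (auto simp: insert_commute)
qed

text \<open>A common neighbour \<open>z\<close> keeps \<open>x\<close> and \<open>y\<close>
  non-adjacent, and two vertices outside the pair share the neighbour \<open>x\<close>. So the graph
  on \<open>V\<close> is exactly complete bipartite.\<close>

lemma dominating_pair_adj:
  assumes "dominating_pair V x y" "V - {x, y} \<noteq> {}" "u \<in> V" "v \<in> V"
  shows "adj u v \<longleftrightarrow> (u \<in> {x, y}) \<noteq> (v \<in> {x, y})"
proof -
  obtain z where z: "z \<in> V" "z \<noteq> x" "z \<noteq> y"
    using assms(2) by blast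
  have dom: "adj x v" "adj y v" "adj v x" "adj v y" if "v \<in> V" "v \<noteq> x" "v \<noteq> y" for v
    using assms(1) that adj_sym unfolding dominating_pair_def by blast+
  have xy: "\<not> adj x y" "\<not> adj y x"
    using dom[OF z] adj_triangle by blast+
  show ?thesis
  proof (cases "u \<in> {x, y}")
    case u: True
    show ?thesis
    proof (cases "v \<in> {x, y}")
      case True
      then have "\<not> adj u v" using u xy adj_irrefl by blast
      then show ?thesis using u True by simp
    next
      case False
      then have "adj u v" using u dom(1,2)[of v] assms(4) by blast
      then show ?thesis using u False by simp
    qed
  next
    case u: False
    show ?thesis
    proof (cases "v \<in> {x, y}")
      case True
      then have "adj u v" using u dom(3,4)[of u] assms(3) by blast
      then show ?thesis using u True by simp
    next
      case False
      have "adj x u" "adj x v"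
        using u False dom(1) assms(3,4) by blast+
      then have "\<not> adj u v" using adj_triangle by blast
      then show ?thesis using u False by simp
    qed
  qed
qed

text \<open>Every 4-cycle has \<open>{x, y}\<close> as one diagonal, and the other diagonal can be
  any pair of the remaining vertices.\<close>

lemma card_c4_sets_dominating_pair:
  assumes dom: "dominating_pair V x y" and fin: "finite V" and ne: "V - {x, y} \<noteq> {}"
  shows "card (c4_sets V) = (card V - 2) choose 2"
proof -
  let ?T = "{T. T \<subseteq> V - {x, y} \<and> card T = 2}"
  have xy: "x \<in> V" "y \<in> V" "x \<noteq> y"
    using dom by (auto simp: dominating_pair_def)
  note adj = dominating_pair_adj[OF dom ne]
  have "c4_sets V = (\<lambda>T. insert x (insert y T)) ` ?T"
  proof (intro equalityI subsetI)
    fix S assume S: "S \<in> c4_sets V"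
    then obtain p q r s where *: "S = {p, q, r, s}" "S \<subseteq> V" "p \<noteq> r" "q \<noteq> s"
      "adj p q" "adj p s" "adj r q" "adj r s"
      using c4_setsE[OF S] by metis
    \<comment> \<open>Adjacent vertices lie in different classes, so \<open>p\<close> and
      \<open>r\<close> share a class, as do \<open>q\<close> and \<open>s\<close>; the pair inside
      \<open>{x, y}\<close> fills it by distinctness.\<close>
    have "({p, r} = {x, y} \<and> q \<notin> {x, y} \<and> s \<notin> {x, y}) \<or> ({q, s} = {x, y} \<and> p \<notin> {x, y} \<and> r \<notin> {x, y})"
      using * adj[of p q] adj[of p s] adj[of r q] adj[of r s] by auto
    then show "S \<in> (\<lambda>T. insert x (insert y T)) ` ?T"
    proof
      assume **: "{p, r} = {x, y} \<and> q \<notin> {x, y} \<and> s \<notin> {x, y}"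
      have "S = {p, r} \<union> {q, s}" using *(1) by auto
      then have "S = insert x (insert y {q, s})" using ** by auto
      moreover have "{q, s} \<in> ?T" using * ** by auto
      ultimately show ?thesis by blast
    next
      assume **: "{q, s} = {x, y} \<and> p \<notin> {x, y} \<and> r \<notin> {x, y}"
      have "S = {q, s} \<union> {p, r}" using *(1) by auto
      then have "S = insert x (insert y {p, r})" using ** by auto
      moreover have "{p, r} \<in> ?T" using * ** by auto
      ultimately show ?thesis by blast
    qed
  next
    fix S assume "S \<in> (\<lambda>T. insert x (insert y T)) ` ?T"
    then obtain T where T: "S = insert x (insert y T)" "T \<subseteq> V - {x, y}" "card T = 2"
      by auto
    then obtain a b where ab: "T = {a, b}" "a \<noteq> b"
      by (auto simp: card_2_iff)
    have "{x, a, y, b} \<in> c4_sets V"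
      using T ab xy adj[of x] adj[of y] by (intro c4_setsI) auto
    moreover have "S = {x, a, y, b}" using T ab by auto
    ultimately show "S \<in> c4_sets V" by simp
  qed
  moreover have "inj_on (\<lambda>T. insert x (insert y T)) ?T"
    by (rule inj_onI) blast
  ultimately have "card (c4_sets V) = card ?T"
    by (simp add: card_image)
  also have "\<dots> = card (V - {x, y}) choose 2"
    using fin by (simp add: n_subsets)
  also have "card (V - {x, y}) = card V - 2"
    using xy fin by (simp add: card_Diff_subset)
  finally show ?thesis .
qed

section \<open>Counting edges and diagonals\<close>

abbreviation edges_in :: "'a set \<Rightarrow> 'a set set" where
  "edges_in V \<equiv> {e. e \<subseteq> V \<and> card e = 2 \<and> e \<in> E}"

lemma c4_sets_edges:
  assumes S: "S \<in> c4_sets V" and "finite V"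
  shows "4 \<le> card (edges_in S)"
proof -
  obtain x a y b where *: "S = {x, a, y, b}" "distinct [x, a, y, b]"
    "adj x a" "adj x b" "adj y a" "adj y b"
    using c4_setsE[OF S] by metis
  have "finite (edges_in S)"
    using *(1) by simp
  then have "card {{x, a}, {x, b}, {y, a}, {y, b}} \<le> card (edges_in S)"
    by (rule card_mono) (use * in \<open>auto simp: adj_def\<close>)
  moreover have "card {{x, a}, {x, b}, {y, a}, {y, b}} = 4"
    using *(2) by (auto simp: doubleton_eq_iff card_insert_if)
  ultimately show ?thesis by simp
qed

text \<open>The second 4-cycle has a vertex outside the first, and an edge at that vertex is a fifth
  edge.\<close>

lemma two_c4_sets_edges:
  assumes S: "S \<in> c4_sets V" and S': "S' \<in> c4_sets V" and "S \<noteq> S'" and fin: "finite V"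
  shows "5 \<le> card (edges_in V)"
proof -
  obtain x a y b where *: "S = {x, a, y, b}" "distinct [x, a, y, b]" "S \<subseteq> V"
    using c4_setsE[OF S] by metis
  obtain x' a' y' b' where **: "S' = {x', a', y', b'}" "distinct [x', a', y', b']" "S' \<subseteq> V"
    "adj x' a'" "adj x' b'" "adj y' a'" "adj y' b'"
    using c4_setsE[OF S'] by metis
  have "card S = 4" "card S' = 4"
    using * ** by auto
  then have "\<not> S' \<subseteq> S"
    using *(1) \<open>S \<noteq> S'\<close> by (metis card_subset_eq finite.emptyI finite_insert)
  then obtain v where v: "v \<in> S'" "v \<notin> S" by blast
  obtain w where w: "w \<in> S'" "adj v w"
    using v(1) ** adj_sym unfolding **(1) by blast
  have "v \<noteq> w"
    using w(2) adj_irrefl by blast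
  then have "{v, w} \<in> edges_in V" "{v, w} \<notin> edges_in S"
    using v w **(3) by (auto simp: adj_def)
  then have "insert {v, w} (edges_in S) \<subseteq> edges_in V"
    using *(3) by auto
  then have "card (insert {v, w} (edges_in S)) \<le> card (edges_in V)"
    using fin by (intro card_mono) auto
  moreover have "finite (edges_in S)"
    using *(1) by simp
  ultimately show ?thesis
    using c4_sets_edges[OF S fin] \<open>{v, w} \<notin> edges_in S\<close> by simp
qed

text \<open>Each diagonal determines its 4-cycle, so the diagonals of the 4-cycles together with the edges
  form \<open>2 * card (c4_sets V) + card (edges_in V)\<close> different pairs of vertices.\<close>

lemma c4_sets_small_codegree:
  assumes fin: "finite V"
    and small: "\<And>x y a b c. {x, y, a, b, c} \<subseteq> V \<Longrightarrow> distinct [x, y, a, b, c] \<Longrightarrow>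
      \<exists>u\<in>{a, b, c}. \<not> adj x u \<or> \<not> adj y u"
  shows "2 * card (c4_sets V) + card (edges_in V) \<le> card V choose 2"
proof -
  define diag where "diag S = {e. e \<subseteq> S \<and> card e = 2 \<and> e \<notin> E}" for S
  have card_diag: "card (diag S) = 2" if S: "S \<in> c4_sets V" for S
  proof -
    obtain x a y b where *: "S = {x, a, y, b}" "distinct [x, a, y, b]"
      "adj x a" "adj x b" "adj y a" "adj y b" "\<not> adj x y" "\<not> adj a b"
      using c4_setsE[OF S] by metis
    have sym: "adj a x" "adj b x" "adj a y" "adj b y"
      using * adj_sym by blast+
    have "diag S = {{x, y}, {a, b}}"
    proof (intro equalityI subsetI)
      fix e assume e: "e \<in> diag S"
      then obtain u v where uv: "e = {u, v}" "u \<noteq> v"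
        by (auto simp: diag_def card_2_iff)
      then have "u \<in> S" "v \<in> S" "\<not> adj u v"
        using e by (auto simp: diag_def adj_def)
      then show "e \<in> {{x, y}, {a, b}}"
        using uv * sym by (auto simp: insert_commute)
    next
      fix e assume "e \<in> {{x, y}, {a, b}}"
      then show "e \<in> diag S"
        using * by (auto simp: diag_def adj_def)
    qed
    then show ?thesis
      using *(2) by (auto simp: doubleton_eq_iff card_insert_if)
  qed
  have disj: "diag S \<inter> diag S' = {}" if S: "S \<in> c4_sets V" and S': "S' \<in> c4_sets V" and "S \<noteq> S'" for S S'
  proof (rule ccontr)
    assume "diag S \<inter> diag S' \<noteq> {}"
    then obtain u w where uw: "{u, w} \<in> diag S" "{u, w} \<in> diag S'" "u \<noteq> w"
      by (auto simp: diag_def card_2_iff)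
    then have mem: "u \<in> S" "w \<in> S" "u \<in> S'" "w \<in> S'" "\<not> adj u w"
      by (auto simp: diag_def adj_def)
    obtain s t where st: "S = {u, s, w, t}" "s \<noteq> t" "adj u s" "adj u t" "adj w s" "adj w t"
      using c4_sets_nonadjacent[OF S mem(1,2) uw(3) mem(5)] .
    obtain s' t' where st': "S' = {u, s', w, t'}" "s' \<noteq> t'" "adj u s'" "adj u t'" "adj w s'" "adj w t'"
      using c4_sets_nonadjacent[OF S' mem(3,4) uw(3) mem(5)] .
    have V: "S \<subseteq> V" "S' \<subseteq> V"
      using S S' by (auto simp: c4_sets_def)
    \<comment> \<open>By \<open>small\<close>, \<open>u\<close> and \<open>w\<close> have no common
      neighbour besides \<open>s\<close> and \<open>t\<close>, so the two cycles share their other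
      diagonal as well.\<close>
    have nbr: "v \<in> {s, t}" if v: "v \<in> S'" "adj u v" "adj w v" for v
    proof (rule ccontr)
      assume "v \<notin> {s, t}"
      then have "distinct [u, w, s, t, v]"
        using uw(3) st v adj_irrefl by auto
      moreover have "{u, w, s, t, v} \<subseteq> V"
        using V st v by auto
      ultimately show False
        using small[of u w s t v] st v by auto
    qed
    have "{s', t'} = {s, t}"
      using nbr[of s'] nbr[of t'] st' by auto
    then have "S = S'"
      unfolding st st' by auto
    then show False using \<open>S \<noteq> S'\<close> by simp
  qed
  let ?D = "\<Union> (diag ` c4_sets V)"
  have fin': "finite (c4_sets V)"
    using finite_c4_sets fin .
  have finS: "finite (diag S)" if "S \<in> c4_sets V" for S
    using card_diag[OF that] by (metis card.infinite zero_neq_numeral)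
  have "card ?D = (\<Sum>S\<in>c4_sets V. card (diag S))"
    using fin' finS disj by (intro card_UN_disjoint) auto
  then have "2 * card (c4_sets V) = card ?D"
    by (simp add: card_diag)
  moreover have "card (?D \<union> edges_in V) = card ?D + card (edges_in V)"
    using fin fin' finS by (intro card_Un_disjoint) (auto simp: diag_def)
  moreover have "card (?D \<union> edges_in V) \<le> card {e. e \<subseteq> V \<and> card e = 2}"
    using fin by (intro card_mono) (auto simp: diag_def c4_sets_def)
  ultimately show ?thesis
    using fin by (simp add: n_subsets)
qed

text \<open>A 4-cycle separating \<open>A\<close> from \<open>B\<close>: a 4-cycle meeting both sides has one diagonal
  \<open>{u, w}\<close> with \<open>u \<in> A\<close>, \<open>w \<in> B\<close>, and its other diagonal is a diagonal of the separating cycle,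
  which one being determined by \<open>u\<close> as there are no triangles.\<close>

lemma c4_sets_separating:
  assumes fin: "finite A" "finite B"
    and disj: "A \<inter> {x, a, y, b} = {}" "B \<inter> {x, a, y, b} = {}"
    and c4: "x \<noteq> y" "a \<noteq> b" "adj x a" "adj x b" "adj y a" "adj y b"
    and sep: "\<And>u w. u \<in> A \<Longrightarrow> w \<in> B \<Longrightarrow> u \<noteq> w \<and> \<not> adj u w"
  defines "C \<equiv> {x, a, y, b}"
  defines "R \<equiv> {(u, w) \<in> A \<times> B. (adj x u \<and> adj y u \<and> adj x w \<and> adj y w) \<or>
    (adj a u \<and> adj b u \<and> adj a w \<and> adj b w)}"
  shows "card (c4_sets (A \<union> B \<union> C)) + 1 \<le> card (c4_sets (A \<union> C)) + card (c4_sets (B \<union> C)) + card R"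
proof -
  define f where "f = (\<lambda>(u, w). if adj x u then {u, w, x, y} else {u, w, a, b})"
  have sub: "c4_sets (A \<union> B \<union> C) \<subseteq> (c4_sets (A \<union> C) \<union> c4_sets (B \<union> C)) \<union> f ` R"
  proof
    fix S assume S: "S \<in> c4_sets (A \<union> B \<union> C)"
    then have SV: "S \<subseteq> A \<union> B \<union> C" by (auto simp: c4_sets_def)
    show "S \<in> (c4_sets (A \<union> C) \<union> c4_sets (B \<union> C)) \<union> f ` R"
    proof (cases "S \<subseteq> A \<union> C \<or> S \<subseteq> B \<union> C")
      case True
      then show ?thesis using S by (auto simp: c4_sets_def)
    next
      case False
      then obtain u w where uw: "u \<in> S" "u \<in> A" "w \<in> S" "w \<in> B"
        using SV by blast
      then have "u \<noteq> w" "\<not> adj u w"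
        using sep by blast+
      then obtain s t where st: "S = {u, s, w, t}" "s \<noteq> t" "adj u s" "adj u t" "adj w s" "adj w t"
        using c4_sets_nonadjacent[OF S uw(1,3)] by metis
      have "s \<in> C" "t \<in> C"
        using SV st sep uw adj_sym by blast+
      moreover have "\<not> adj s t" "\<not> adj t s"
        using st adj_triangle adj_sym by blast+
      ultimately have "{s, t} = {x, y} \<or> {s, t} = {a, b}"
        using c4 st(2) adj_sym unfolding C_def by blast
      then show ?thesis
      proof
        assume *: "{s, t} = {x, y}"
        then have "adj x u" "adj y u" "adj x w" "adj y w"
          using st adj_sym by (auto simp: doubleton_eq_iff)
        moreover have "S = {u, w} \<union> {s, t}" using st by auto
        ultimately have "(u, w) \<in> R" "S = f (u, w)"
          using uw unfolding * by (auto simp: R_def f_def)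
        then show ?thesis by blast
      next
        assume *: "{s, t} = {a, b}"
        then have ab: "adj a u" "adj b u" "adj a w" "adj b w"
          using st adj_sym by (auto simp: doubleton_eq_iff)
        moreover have "\<not> adj x u"
          using ab(1) c4(3) adj_triangle by blast
        moreover have "S = {u, w} \<union> {s, t}" using st by auto
        ultimately have "(u, w) \<in> R" "S = f (u, w)"
          using uw unfolding * by (auto simp: R_def f_def)
        then show ?thesis by blast
      qed
    qed
  qed
  have finC: "finite (c4_sets (A \<union> C))" "finite (c4_sets (B \<union> C))" "finite R"
    using fin finite_c4_sets[of "A \<union> C"] finite_c4_sets[of "B \<union> C"]
    by (auto simp: C_def R_def intro: finite_subset[of _ "A \<times> B"])
  \<comment> \<open>The separating cycle lies in both halves, which accounts for the
    \<open>+ 1\<close>.\<close>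
  have "C \<in> c4_sets (A \<union> C) \<inter> c4_sets (B \<union> C)"
    unfolding C_def using c4 by (auto intro!: c4_setsI)
  then have "card {C} \<le> card (c4_sets (A \<union> C) \<inter> c4_sets (B \<union> C))"
    using finC by (intro card_mono) auto
  then have "1 \<le> card (c4_sets (A \<union> C) \<inter> c4_sets (B \<union> C))"
    by simp
  then have "card (c4_sets (A \<union> C) \<union> c4_sets (B \<union> C)) + 1 \<le> card (c4_sets (A \<union> C)) + card (c4_sets (B \<union> C))"
    using card_Un_Int[OF finC(1,2)] by linarith
  moreover have "card (c4_sets (A \<union> B \<union> C)) \<le> card ((c4_sets (A \<union> C) \<union> c4_sets (B \<union> C)) \<union> f ` R)"
    using finC sub by (intro card_mono) auto
  moreover have "\<dots> \<le> card (c4_sets (A \<union> C) \<union> c4_sets (B \<union> C)) + card (f ` R)"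
    by (rule card_Un_le)
  moreover have "card (f ` R) \<le> card R"
    by (rule card_image_le[OF finC(3)])
  ultimately show ?thesis by linarith
qed

section \<open>The extremal bound by induction\<close>

text \<open>Both halves contain the separating cycle, so they keep at least four vertices, and both
  are proper because each side is nonempty. Only the numerical bound is taken from the induction
  hypothesis; equality is read off from the cycles that meet both sides.\<close>

theorem card_c4_sets_bound:
  assumes "finite V" "4 \<le> card V" "theta_separation V E"
  shows "card (c4_sets V) \<le> (card V - 2) choose 2 \<and>
    (card (c4_sets V) = (card V - 2) choose 2 \<longrightarrow> (\<exists>x y. dominating_pair V x y))"
  using assms
proof (induction "card V" arbitrary: V rule: less_induct)
  case less
  note fin = \<open>finite V\<close>
  show ?case
  proof (cases "\<exists>x y a b c. {x, y, a, b, c} \<subseteq> V \<and> distinct [x, y, a, b, c] \<and>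
      (\<forall>u\<in>{a, b, c}. adj x u \<and> adj y u)")
    case False
    obtain k where k: "card V = k + 4"
      using less.prems(2) by (metis add.commute le_Suc_ex)
    let ?q = "card (c4_sets V)" and ?e = "card (edges_in V)"
    have "2 * ?q + ?e \<le> card V choose 2"
      using False by (intro c4_sets_small_codegree[OF fin]) blast
    moreover have "4 \<le> ?e" if q: "1 \<le> ?q"
    proof -
      have "c4_sets V \<noteq> {}"
        using q by auto
      then obtain S where S: "S \<in> c4_sets V"
        by blast
      then have "card (edges_in S) \<le> ?e"
        using fin by (intro card_mono) (auto simp: c4_sets_def)
      then show ?thesis
        using c4_sets_edges[OF S fin] by linarith
    qed
    moreover have "5 \<le> ?e" if q: "2 \<le> ?q"
    proof -
      obtain S S' where S: "S \<in> c4_sets V" "S' \<in> c4_sets V" "S \<noteq> S'"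
        using q card_le_Suc0_iff_eq[OF finite_c4_sets[OF fin]] by fastforce
      then show ?thesis
        by (rule two_c4_sets_edges[OF _ _ _ fin])
    qed
    ultimately have q: "?q \<le> (k + 2) choose 2" "?q = (k + 2) choose 2 \<Longrightarrow> k = 0"
      using choose_two_sum_bound[of ?q ?e k] unfolding k by blast+
    have "\<exists>x y. dominating_pair V x y" if "?q = (k + 2) choose 2"
    proof -
      \<comment> \<open>Equality leaves only four vertices and the value \<open>1\<close>, so
        \<open>V\<close> is itself a 4-cycle and its diagonal dominates it.\<close>
      have k0: "k = 0" using q(2) that .
      then have "c4_sets V \<noteq> {}"
        using that by auto
      then obtain S where S: "S \<in> c4_sets V"
        by blast
      obtain x a y b where *: "S = {x, a, y, b}" "S \<subseteq> V" "distinct [x, a, y, b]"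
        "adj x a" "adj x b" "adj y a" "adj y b"
        using c4_setsE[OF S] by metis
      have "S = V"
        using * k k0 fin by (intro card_subset_eq) auto
      then have "dominating_pair V x y"
        using * by (auto simp: dominating_pair_def)
      then show ?thesis by blast
    qed
    then show ?thesis
      using q(1) by (simp add: k)
  next
    case True
    then obtain x y a b c where V: "{x, y, a, b, c} \<subseteq> V" and dist: "distinct [x, y, a, b, c]"
      and adj: "\<And>u. u \<in> {a, b, c} \<Longrightarrow> adj x u \<and> adj y u"
      by blast
    show ?thesis
    proof (cases "V = {x, y, a, b, c}")
      case True
      then have "dominating_pair V x y"
        using dist adj by (auto simp: dominating_pair_def)
      moreover have "V - {x, y} \<noteq> {}"
        using True dist by auto
      ultimately show ?thesis
        using card_c4_sets_dominating_pair[OF _ fin] by (metis order_refl)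
    next
      case False
      then obtain w where w: "w \<in> V" "w \<notin> {x, y, a, b, c}"
        using V by blast
      have "distinct [x, y, a, b, c, w] \<and> {x, y, a, b, c, w} \<subseteq> V \<and>
          (\<forall>u\<in>{a, b, c}. {x, u} \<in> E \<and> {y, u} \<in> E)"
        using V dist adj w unfolding adj_def by auto
      then obtain D where D: "D \<subseteq> V - {x, y, a, b, c}" "w \<in> D"
          "\<forall>d\<in>D. \<forall>v\<in>V - {x, y, a, b, c} - D. {d, v} \<notin> E"
          "\<exists>u\<in>{a, b, c}. \<forall>d\<in>D. {d, u} \<notin> E"
        using less.prems(3)[unfolded theta_separation_def, rule_format, of x y a b c w] by metis
      obtain u where u: "u \<in> {a, b, c}" "\<And>d. d \<in> D \<Longrightarrow> \<not> adj d u"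
        using D(4) unfolding adj_def by blast
      have D_rest: "\<not> adj d v" if "d \<in> D" "v \<in> V - {x, y, a, b, c} - D" for d v
        using D(3) that unfolding adj_def by blast
      \<comment> \<open>Relabelling: \<open>u\<close> is the middle vertex without neighbours in
        \<open>D\<close>, and the other two form the separating 4-cycle \<open>C\<close> with
        \<open>x\<close> and \<open>y\<close>. As \<open>u\<close> is then counted to
        \<open>B\<close>, that side is nonempty.\<close>
      obtain a' b' where ab: "{a, b, c} = {u, a', b'}" "distinct [u, a', b']"
      proof -
        consider "u = a" | "u = b" | "u = c" using u(1) by blast
        then show thesis
          using that[of b c] that[of a c] that[of a b] dist by cases auto
      qed
      then have adj': "adj x u" "adj y u" "adj x a'" "adj x b'" "adj y a'" "adj y b'"
        using adj by blast+
      have N: "{x, y, a, b, c} = {x, y, u, a', b'}"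
        using ab(1) by blast
      have nx: "distinct [x, y, u, a', b']"
        using dist ab adj' adj_irrefl by auto
      define C where "C = {x, a', y, b'}"
      define B where "B = V - C - D"
      have disj: "D \<inter> C = {}" "B \<inter> C = {}" "D \<inter> B = {}" and VU: "V = D \<union> B \<union> C"
        using D(1) V unfolding N B_def C_def by blast+
      have "u \<in> B"
        using nx V D(1) unfolding N B_def C_def by auto
      have fin': "finite D" "finite B" "finite C"
        using fin VU by (auto simp: C_def)
      have sep: "v \<noteq> z \<and> \<not> adj v z" if "v \<in> D" "z \<in> B" for v z
      proof
        show "v \<noteq> z" using that disj by blast
        \<comment> \<open>The rest of \<open>B\<close> lies off the theta curve and outside
          \<open>D\<close>, where the separation property applies.\<close>
        have "z = u \<or> z \<in> V - {x, y, a, b, c} - D"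
          using that(2) unfolding N B_def C_def by blast
        then show "\<not> adj v z"
          using D_rest[of v z] u(2)[of v] that(1) by blast
      qed
      have "card C = 4"
        using nx by (auto simp: C_def)
      then have cardC: "card (D \<union> C) = card D + 4" "card (B \<union> C) = card B + 4"
          "card V = card D + card B + 4"
        using disj fin' by (auto simp: VU card_Un_disjoint Int_Un_distrib2)
      have pos: "0 < card D" "0 < card B"
        using D(2) \<open>u \<in> B\<close> fin' by (auto simp: card_gt_0_iff)
      have IH: "card (c4_sets (X \<union> C)) \<le> (card X + 2) choose 2"
        if "X \<union> C \<subseteq> V" "card (X \<union> C) = card X + 4" "card X + 4 < card V" for X
        using less.hyps[of "X \<union> C"] that fin theta_separation_mono[OF less.prems(3), of "X \<union> C"]
          finite_subset[OF that(1) fin] by simp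
      define R where "R = {(u, w) \<in> D \<times> B. (adj x u \<and> adj y u \<and> adj x w \<and> adj y w) \<or>
        (adj a' u \<and> adj b' u \<and> adj a' w \<and> adj b' w)}"
      have main: "card (c4_sets V) + 1 \<le> card (c4_sets (D \<union> C)) + card (c4_sets (B \<union> C)) + card R"
        unfolding VU R_def C_def
        by (rule c4_sets_separating) (use fin' disj nx adj' sep in \<open>auto simp: C_def\<close>)
      have "card (c4_sets (D \<union> C)) \<le> (card D + 2) choose 2" "card (c4_sets (B \<union> C)) \<le> (card B + 2) choose 2"
        using IH[of D] IH[of B] VU cardC pos by auto
      moreover have RDB: "R \<subseteq> D \<times> B"
        by (auto simp: R_def)
      then have "card R \<le> card D * card B"
        using card_mono[of "D \<times> B" R] fin' by (simp add: card_cartesian_product)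
      moreover have "((card V - 2) choose 2) + 1 =
          ((card D + 2) choose 2) + ((card B + 2) choose 2) + card D * card B"
        using choose_two_split[of "card D" "card B"] cardC(3) by simp
      ultimately have bound: "card (c4_sets V) \<le> (card V - 2) choose 2"
        "card (c4_sets V) = (card V - 2) choose 2 \<Longrightarrow> card R = card D * card B"
        using main by linarith+
      have "dominating_pair V x y" if "card (c4_sets V) = (card V - 2) choose 2"
      proof -
        \<comment> \<open>Every pair across the cycle must now give a 4-cycle. Since
          \<open>u\<close> is adjacent to \<open>x\<close>, it is not adjacent to \<open>a'\<close>,
          so pairing it with \<open>D\<close> joins \<open>x\<close> and \<open>y\<close> to all of
          \<open>D\<close>; pairing \<open>w\<close> with \<open>B\<close> then does the same for
          \<open>B\<close>.\<close>
        have "R = D \<times> B"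
          using bound(2)[OF that] RDB fin' by (intro card_subset_eq) (auto simp: card_cartesian_product)
        then have R: "(adj x v \<and> adj y v \<and> adj x z \<and> adj y z) \<or>
            (adj a' v \<and> adj b' v \<and> adj a' z \<and> adj b' z)" if "v \<in> D" "z \<in> B" for v z
          using that unfolding R_def by auto
        have not_a: "\<not> adj a' v" if "adj x v" for v
          using that adj'(3) adj_triangle by blast
        have D: "adj x v \<and> adj y v" if "v \<in> D" for v
          using R[OF that \<open>u \<in> B\<close>] not_a[OF adj'(1)] by blast
        have "adj x z \<and> adj y z" if "z \<in> B" for z
          using R[OF \<open>w \<in> D\<close> that] not_a D[OF \<open>w \<in> D\<close>] by blast
        then show ?thesis
          using D V dist adj' unfolding dominating_pair_def VU C_def by auto
      qed
      then show ?thesis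
        using bound(1) by blast
    qed
  qed
qed

end

section \<open>Copies of cycles and drawings of complete bipartite graphs\<close>

text \<open>Reads an isomorphism onto a concrete numbered graph as a labelling of \<open>G\<close>.
  Edges lie inside the vertex set, so the inverse map cancels on them.\<close>

lemma isomorphic_inverse:
  assumes "simple_graph G" "isomorphic G H"
  obtains g where "bij_betw g (verts H) (verts G)" "edges G = (\<lambda>e. g ` e) ` edges H"
proof -
  obtain f where f: "bij_betw f (verts G) (verts H)" "edges H = (\<lambda>e. f ` e) ` edges G"
    using assms(2) by (auto simp: isomorphic_def)
  let ?g = "inv_into (verts G) f"
  have "?g ` f ` e = e" if "e \<in> edges G" for e
    using that assms(1) f(1) by (intro inv_into_image_cancel) (auto simp: simple_graph_def bij_betw_def)
  then have "edges G = (\<lambda>e. ?g ` e) ` edges H"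
    unfolding f(2) by (simp add: image_image)
  then show thesis
    using that bij_betw_inv_into[OF f(1)] by blast
qed

lemma cycle_graph_3: "cycle_graph 3 = Graph {0, 1, 2} {{0, 1}, {1, 2}, {2, 0}}"
proof -
  have vs: "{..<3::nat} = {0, 1, 2}" by auto
  have "{{i, (i + 1) mod 3} | i. i < 3} = (\<lambda>i::nat. {i, (i + 1) mod 3}) ` {..<3}"
    by auto
  also have "\<dots> = {{0, 1}, {1, 2}, {2, 0}}"
    unfolding vs by (simp del: One_nat_def)
  finally show ?thesis
    unfolding cycle_graph_def vs by (rule arg_cong)
qed

lemma cycle_graph_4: "cycle_graph 4 = Graph {0, 1, 2, 3} {{0, 1}, {1, 2}, {2, 3}, {3, 0}}"
proof -
  have vs: "{..<4::nat} = {0, 1, 2, 3}" by auto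
  have "{{i, (i + 1) mod 4} | i. i < 4} = (\<lambda>i::nat. {i, (i + 1) mod 4}) ` {..<4}"
    by auto
  also have "\<dots> = {{0, 1}, {1, 2}, {2, 3}, {3, 0}}"
    unfolding vs by (simp del: One_nat_def)
  finally show ?thesis
    unfolding cycle_graph_def vs by (rule arg_cong)
qed

lemma isomorphic_cycle_graph_3:
  assumes "simple_graph S"
  shows "isomorphic S (cycle_graph 3) \<longleftrightarrow>
    (\<exists>u v w. distinct [u, v, w] \<and> S = Graph {u, v, w} {{u, v}, {v, w}, {w, u}})"
proof
  assume "isomorphic S (cycle_graph 3)"
  then obtain g where g: "bij_betw g {0, 1, 2::nat} (verts S)"
    "edges S = (\<lambda>e. g ` e) ` {{0, 1}, {1, 2}, {2, 0}}"
    using isomorphic_inverse[OF assms] unfolding cycle_graph_3 by (metis ugraph.sel)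
  have "S = Graph {g 0, g 1, g 2} {{g 0, g 1}, {g 1, g 2}, {g 2, g 0}}"
    using g by (intro ugraph.expand) (auto simp: bij_betw_def)
  moreover have "distinct [g 0, g 1, g 2]"
    using g(1) by (auto simp: bij_betw_def)
  ultimately show "\<exists>u v w. distinct [u, v, w] \<and> S = Graph {u, v, w} {{u, v}, {v, w}, {w, u}}"
    by blast
next
  assume "\<exists>u v w. distinct [u, v, w] \<and> S = Graph {u, v, w} {{u, v}, {v, w}, {w, u}}"
  then obtain u v w where S: "distinct [u, v, w]" "S = Graph {u, v, w} {{u, v}, {v, w}, {w, u}}"
    by blast
  define f :: "'a \<Rightarrow> nat" where "f z = (if z = u then 0 else if z = v then 1 else 2)" for z
  have "f u = 0" "f v = 1" "f w = 2"
    using S(1) by (auto simp: f_def)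
  then show "isomorphic S (cycle_graph 3)"
    unfolding isomorphic_def cycle_graph_3 S(2)
    by (intro exI[of _ f]) (auto simp: bij_betw_def)
qed

lemma isomorphic_cycle_graph_4:
  assumes "simple_graph S"
  shows "isomorphic S (cycle_graph 4) \<longleftrightarrow>
    (\<exists>x a y b. distinct [x, a, y, b] \<and> S = Graph {x, a, y, b} {{x, a}, {a, y}, {y, b}, {b, x}})"
proof
  assume "isomorphic S (cycle_graph 4)"
  then obtain g where g: "bij_betw g {0, 1, 2, 3::nat} (verts S)"
    "edges S = (\<lambda>e. g ` e) ` {{0, 1}, {1, 2}, {2, 3}, {3, 0}}"
    using isomorphic_inverse[OF assms] unfolding cycle_graph_4 by (metis ugraph.sel)
  have "S = Graph {g 0, g 1, g 2, g 3} {{g 0, g 1}, {g 1, g 2}, {g 2, g 3}, {g 3, g 0}}"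
    using g by (intro ugraph.expand) (auto simp: bij_betw_def)
  moreover have "distinct [g 0, g 1, g 2, g 3]"
    using g(1) by (auto simp: bij_betw_def)
  ultimately show "\<exists>x a y b. distinct [x, a, y, b] \<and>
      S = Graph {x, a, y, b} {{x, a}, {a, y}, {y, b}, {b, x}}"
    by blast
next
  assume "\<exists>x a y b. distinct [x, a, y, b] \<and> S = Graph {x, a, y, b} {{x, a}, {a, y}, {y, b}, {b, x}}"
  then obtain x a y b where S: "distinct [x, a, y, b]"
    "S = Graph {x, a, y, b} {{x, a}, {a, y}, {y, b}, {b, x}}"
    by blast
  define f :: "'a \<Rightarrow> nat"
    where "f z = (if z = x then 0 else if z = a then 1 else if z = y then 2 else 3)" for z
  have "f x = 0" "f a = 1" "f y = 2" "f b = 3"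
    using S(1) by (auto simp: f_def)
  then show "isomorphic S (cycle_graph 4)"
    unfolding isomorphic_def cycle_graph_4 S(2)
    by (intro exI[of _ f]) (auto simp: bij_betw_def)
qed

lemma free_of_triangle_iff:
  assumes "simple_graph G"
  shows "free_of (cycle_graph 3) G \<longleftrightarrow> triangle_free_edges (edges G)"
proof
  assume free: "free_of (cycle_graph 3) G"
  show "triangle_free_edges (edges G)"
  proof (unfold_locales, rule notI)
    fix u v w assume e: "{u, v} \<in> edges G" "{v, w} \<in> edges G" "{u, w} \<in> edges G"
    then have "card {u, v} = 2" "card {v, w} = 2" "card {u, w} = 2"
      and V: "{u, v, w} \<subseteq> verts G"
      using assms by (auto simp: simple_graph_def)
    then have d: "distinct [u, v, w]"
      by (auto simp: card_insert_if split: if_splits)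
    let ?S = "Graph {u, v, w} {{u, v}, {v, w}, {w, u}}"
    have S: "simple_graph ?S"
      using d by (auto simp: simple_graph_def)
    then have "is_subgraph ?S G"
      using e V by (auto simp: is_subgraph_def insert_commute)
    moreover have "isomorphic ?S (cycle_graph 3)"
      unfolding isomorphic_cycle_graph_3[OF S] using d by blast
    ultimately show False
      using free by (auto simp: free_of_def copies_def)
  qed
next
  assume "triangle_free_edges (edges G)"
  then interpret triangle_free_edges "edges G" .
  have False if S: "is_subgraph S G" "isomorphic S (cycle_graph 3)" for S
  proof -
    have "simple_graph S" using S(1) by (simp add: is_subgraph_def)
    then obtain u v w where "S = Graph {u, v, w} {{u, v}, {v, w}, {w, u}}"
      using S(2) isomorphic_cycle_graph_3 by metis
    then have "{u, v} \<in> edges G" "{v, w} \<in> edges G" "{u, w} \<in> edges G"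
      using S(1) by (auto simp: is_subgraph_def insert_commute)
    then show False using no_triangle by blast
  qed
  then show "free_of (cycle_graph 3) G"
    by (auto simp: free_of_def copies_def)
qed

context triangle_free_edges
begin

text \<open>A copy contains every edge of \<open>G\<close> among its four vertices, as its diagonals
  are not edges. Hence \<open>verts\<close> is a bijection from copies to
  \<open>c4_sets\<close>.\<close>

lemma num_copies_c4:
  assumes G: "simple_graph G" and E: "edges G = E"
  shows "num_copies (cycle_graph 4) G = card (c4_sets (verts G))"
proof -
  let ?K = "copies (cycle_graph 4) G"
  have copyD: "verts S \<in> c4_sets (verts G) \<and> edges S = edges_in (verts S)" if "S \<in> ?K" for S
  proof -
    have S: "is_subgraph S G" "isomorphic S (cycle_graph 4)"
      using that by (auto simp: copies_def)
    then have "simple_graph S" by (simp add: is_subgraph_def)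
    then obtain x a y b where d: "distinct [x, a, y, b]"
      and eq: "S = Graph {x, a, y, b} {{x, a}, {a, y}, {y, b}, {b, x}}"
      using S(2) isomorphic_cycle_graph_4 by metis
    have a: "adj x a" "adj a y" "adj y b" "adj b x"
      using S(1) E eq by (auto simp: is_subgraph_def adj_def)
    then have a': "adj x b" "adj y a"
      using adj_sym by blast+
    have n: "\<not> adj x y" "\<not> adj a b" "\<not> adj y x" "\<not> adj b a"
      using a a' adj_triangle adj_sym by blast+
    have "verts S \<in> c4_sets (verts G)"
      using S(1) a a' d unfolding eq by (auto simp: is_subgraph_def intro!: c4_setsI)
    moreover have "edges S = edges_in (verts S)"
    proof (intro equalityI subsetI)
      fix e assume "e \<in> edges S"
      then show "e \<in> edges_in (verts S)"
        using a d unfolding eq by (auto simp: adj_def)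
    next
      fix e assume e: "e \<in> edges_in (verts S)"
      then obtain u v where uv: "e = {u, v}" "u \<noteq> v"
        by (auto simp: card_2_iff)
      then have "u \<in> {x, a, y, b}" "v \<in> {x, a, y, b}" "adj u v"
        using e eq by (auto simp: adj_def)
      then show "e \<in> edges S"
        using uv n unfolding eq by (auto simp: insert_commute)
    qed
    ultimately show ?thesis ..
  qed
  have "bij_betw verts ?K (c4_sets (verts G))"
    unfolding bij_betw_def
  proof
    show "inj_on verts ?K"
    proof (rule inj_onI)
      fix S S' assume "S \<in> ?K" "S' \<in> ?K" "verts S = verts S'"
      then show "S = S'"
        using copyD[of S] copyD[of S'] by (intro ugraph.expand) auto
    qed
    show "verts ` ?K = c4_sets (verts G)"
    proof (intro equalityI subsetI)
      fix W assume W: "W \<in> c4_sets (verts G)"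
      then obtain x a y b where *: "W = {x, a, y, b}" "W \<subseteq> verts G" "distinct [x, a, y, b]"
        "adj x a" "adj x b" "adj y a" "adj y b"
        using c4_setsE[OF W] by metis
      let ?S = "Graph {x, a, y, b} {{x, a}, {a, y}, {y, b}, {b, x}}"
      have S: "simple_graph ?S"
        using *(3) by (auto simp: simple_graph_def)
      moreover have "adj a y" "adj b x"
        using * adj_sym by blast+
      ultimately have "is_subgraph ?S G"
        using * E by (auto simp: is_subgraph_def adj_def)
      moreover have "isomorphic ?S (cycle_graph 4)"
        unfolding isomorphic_cycle_graph_4[OF S] using *(3) by blast
      ultimately have "?S \<in> ?K" by (simp add: copies_def)
      then show "W \<in> verts ` ?K"
        using *(1) by (metis image_eqI ugraph.sel(1))
    qed (use copyD in blast)
  qed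
  then show ?thesis
    unfolding num_copies_def by (rule bij_betw_same_card)
qed

end

section \<open>The graphs K_{2,n-2}\<close>

text \<open>A complete bipartite graph with two-element class \<open>{x, y}\<close>, expressed
  inside \<open>G\<close> without numbering its vertices.\<close>

definition double_star :: "'a ugraph \<Rightarrow> 'a \<Rightarrow> 'a \<Rightarrow> bool" where
  "double_star G x y \<longleftrightarrow> x \<in> verts G \<and> y \<in> verts G \<and> x \<noteq> y \<and>
     edges G = {{s, v} | s v. s \<in> {x, y} \<and> v \<in> verts G - {x, y}}"

text \<open>The numbers \<open>0\<close> and \<open>1\<close> correspond to \<open>x\<close> and
  \<open>y\<close>; any bijection from the other vertices to \<open>{2..<n}\<close> completes an
  isomorphism.\<close>

lemma isomorphic_complete_bipartite_2_iff:
  fixes G :: "'a ugraph"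
  assumes G: "simple_graph G" and n: "2 \<le> n"
  shows "isomorphic G (complete_bipartite 2 (n - 2)) \<longleftrightarrow>
    card (verts G) = n \<and> (\<exists>x y. double_star G x y)"
proof -
  let ?K = "complete_bipartite 2 (n - 2)"
  have K: "verts ?K = {..<n}" "edges ?K = {{i, j} | i j. i < 2 \<and> 2 \<le> j \<and> j < n}"
    unfolding complete_bipartite_def ugraph.sel le_add_diff_inverse[OF n] by (rule refl)+
  show ?thesis
  proof
    assume "isomorphic G ?K"
    then obtain g where g: "bij_betw g {..<n} (verts G)"
      "edges G = (\<lambda>e. g ` e) ` {{i, j} | i j. i < 2 \<and> 2 \<le> j \<and> j < n}"
      using isomorphic_inverse[OF G] unfolding K[symmetric] by metis
    have inj: "inj_on g {..<n}" and im: "g ` {..<n} = verts G"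
      using g(1) by (auto simp: bij_betw_def)
    have ne: "g 0 \<in> verts G" "g 1 \<in> verts G" "g 0 \<noteq> g 1"
      using n inj im inj_on_eq_iff[OF inj, of 0 1] by auto
    have rest: "v \<in> verts G - {g 0, g 1} \<longleftrightarrow> (\<exists>j. 2 \<le> j \<and> j < n \<and> v = g j)" for v
    proof
      assume v: "v \<in> verts G - {g 0, g 1}"
      then obtain j where j: "j < n" "v = g j"
        using im by auto
      then have "j \<noteq> 0" "j \<noteq> 1" using v by (metis DiffD2 insertCI)+
      then show "\<exists>j. 2 \<le> j \<and> j < n \<and> v = g j"
        using j by (intro exI[of _ j]) auto
    next
      assume "\<exists>j. 2 \<le> j \<and> j < n \<and> v = g j"
      then obtain j where j: "2 \<le> j" "j < n" "v = g j" by blast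
      then show "v \<in> verts G - {g 0, g 1}"
        using im inj_on_eq_iff[OF inj, of j 0] inj_on_eq_iff[OF inj, of j 1] n by auto
    qed
    have "edges G = {{s, v} | s v. s \<in> {g 0, g 1} \<and> v \<in> verts G - {g 0, g 1}}"
    proof (intro equalityI subsetI)
      fix e assume "e \<in> edges G"
      then obtain i j where ij: "i < 2" "2 \<le> j" "j < n" "e = {g i, g j}"
        unfolding g(2) by auto
      moreover have "g i \<in> {g 0, g 1}"
        using ij(1) by (auto simp: less_2_cases_iff)
      ultimately show "e \<in> {{s, v} | s v. s \<in> {g 0, g 1} \<and> v \<in> verts G - {g 0, g 1}}"
        using rest by blast
    next
      fix e assume "e \<in> {{s, v} | s v. s \<in> {g 0, g 1} \<and> v \<in> verts G - {g 0, g 1}}"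
      then obtain s v where sv: "e = {s, v}" "s \<in> {g 0, g 1}" "v \<in> verts G - {g 0, g 1}"
        by blast
      obtain i :: nat where "i < 2" "s = g i"
        using sv(2) by (metis insertE empty_iff less_2_cases_iff One_nat_def)
      moreover obtain j where "2 \<le> j" "j < n" "v = g j"
        using sv(3) rest by blast
      ultimately have "e = g ` {i, j}" "{i, j} \<in> {{i, j} | i j. i < 2 \<and> 2 \<le> j \<and> j < n}"
        using sv(1) by auto
      then show "e \<in> edges G"
        unfolding g(2) by blast
    qed
    then have "double_star G (g 0) (g 1)"
      using ne by (simp add: double_star_def)
    moreover have "card (verts G) = n"
      using bij_betw_same_card[OF g(1)] by simp
    ultimately show "card (verts G) = n \<and> (\<exists>x y. double_star G x y)"
      by blast
  next
    assume "card (verts G) = n \<and> (\<exists>x y. double_star G x y)"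
    then obtain x y where card: "card (verts G) = n" and st: "double_star G x y" by blast
    have fin: "finite (verts G)" using G by (simp add: simple_graph_def)
    have xy: "x \<in> verts G" "y \<in> verts G" "x \<noteq> y"
      and E: "edges G = {{s, v} | s v. s \<in> {x, y} \<and> v \<in> verts G - {x, y}}"
      using st by (auto simp: double_star_def)
    let ?W = "verts G - {x, y}"
    have "card ?W = card {2..<n}"
      using xy fin card by (simp add: card_Diff_subset)
    then obtain h where h: "bij_betw h ?W {2..<n}"
      using finite_same_card_bij[of ?W "{2..<n}"] fin by auto
    define f where "f v = (if v = x then 0 else if v = y then 1 else h v)" for v
    have f: "f x = 0" "f y = 1" "\<And>v. v \<in> ?W \<Longrightarrow> f v = h v"
      using xy(3) by (auto simp: f_def)
    have "bij_betw f ?W {2..<n}"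
      using h bij_betw_cong[of ?W f h, OF f(3)] by blast
    moreover have "bij_betw f {x, y} {0, 1}"
      using f xy(3) by (auto simp: bij_betw_def)
    ultimately have "bij_betw f ({x, y} \<union> ?W) ({0, 1} \<union> {2..<n})"
      by (intro bij_betw_combine) auto
    moreover have "{x, y} \<union> ?W = verts G" "{0, 1} \<union> {2..<n} = {..<n}"
      using xy n by auto
    ultimately have bij: "bij_betw f (verts G) {..<n}"
      by simp
    have im: "f ` ?W = {2..<n}"
      using \<open>bij_betw f ?W {2..<n}\<close> by (simp add: bij_betw_def)
    have "edges ?K = (\<lambda>e. f ` e) ` edges G"
    proof (intro equalityI subsetI)
      fix e assume "e \<in> edges ?K"
      then obtain i j where ij: "e = {i, j}" "i < 2" "2 \<le> j" "j < n"
        unfolding K by blast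
      obtain v where v: "v \<in> ?W" "f v = j"
        using im ij(3,4) by (metis atLeastLessThan_iff imageE)
      obtain s where s: "s \<in> {x, y}" "f s = i"
        using f(1,2) ij(2) by (metis One_nat_def insertCI less_2_cases)
      have "{s, v} \<in> edges G" "e = f ` {s, v}"
        using v s ij(1) unfolding E by auto
      then show "e \<in> (\<lambda>e. f ` e) ` edges G"
        by blast
    next
      fix e assume "e \<in> (\<lambda>e. f ` e) ` edges G"
      then obtain s v where sv: "e = {f s, f v}" "s \<in> {x, y}" "v \<in> ?W"
        unfolding E by auto
      have "f s < 2" using sv(2) f by auto
      moreover have "2 \<le> f v" "f v < n"
        using im sv(3) by auto
      ultimately show "e \<in> edges ?K"
        unfolding K using sv(1) by blast
    qed
    then show "isomorphic G ?K"
      unfolding isomorphic_def K(1) using bij by blast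
  qed
qed

lemma double_star_triangle_free:
  assumes "double_star G x y"
  shows "triangle_free_edges (edges G)"
proof
  have split: "(u \<in> {x, y}) \<noteq> (v \<in> {x, y})" if "{u, v} \<in> edges G" for u v
    using that assms by (auto simp: double_star_def doubleton_eq_iff)
  show "{u, w} \<notin> edges G" if "{u, v} \<in> edges G" "{v, w} \<in> edges G" for u v w
    using split[of u v] split[of v w] split[of u w] that by blast
qed

lemma in_segment_from_imaginary_axis:
  "z \<in> closed_segment (Complex 0 c) (Complex r 0) \<longleftrightarrow>
    (\<exists>t. 0 \<le> t \<and> t \<le> 1 \<and> Re z = t * r \<and> Im z = (1 - t) * c)"
  by (auto simp: closed_segment_def complex_eq_iff)

text \<open>A straight-line drawing: \<open>x\<close> and \<open>y\<close> are placed at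
  \<open>i\<close> and \<open>-i\<close>, the other vertices at distinct points of the real axis.
  Segments from different poles can meet only on that axis, and different segments from one pole
  only at the pole.\<close>

lemma double_star_planar:
  assumes st: "double_star G x y" and fin: "finite (verts G)"
  shows "planar G"
proof -
  let ?W = "verts G - {x, y}"
  have xy: "x \<in> verts G" "y \<in> verts G" "x \<noteq> y"
    and E: "edges G = {{s, v} | s v. s \<in> {x, y} \<and> v \<in> ?W}"
    using st by (auto simp: double_star_def)
  obtain h :: "'a \<Rightarrow> nat" where h: "inj_on h (verts G)"
    using finite_imp_inj_to_nat_seg[OF fin] by blast
  define c :: "'a \<Rightarrow> real" where "c s = (if s = x then 1 else - 1)" for s
  define p where "p v = (if v \<in> {x, y} then Complex 0 (c v) else Complex (real (h v)) 0)" for v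
  \<comment> \<open>The arc must depend on the edge as a set; its ends are recovered as its unique
    elements inside and outside \<open>{x, y}\<close>.\<close>
  define \<gamma> where "\<gamma> e = linepath (p (the_elem (e \<inter> {x, y}))) (p (the_elem (e - {x, y})))" for e
  have c: "c s \<noteq> 0" "s \<in> {x, y} \<Longrightarrow> s' \<in> {x, y} \<Longrightarrow> c s = c s' \<longleftrightarrow> s = s'" for s s'
    using xy(3) by (auto simp: c_def)
  have p1: "p s = Complex 0 (c s)" if "s \<in> {x, y}" for s
    using that by (simp add: p_def)
  have p2: "p v = Complex (real (h v)) 0" if "v \<in> ?W" for v
    using that by (simp add: p_def)
  have h_eq: "h v = h w \<longleftrightarrow> v = w" if "v \<in> ?W" "w \<in> ?W" for v w
    using h that by (auto simp: inj_on_def)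
  have inj: "inj_on p (verts G)"
  proof (rule inj_onI)
    fix v w assume "v \<in> verts G" "w \<in> verts G" and eq: "p v = p w"
    then consider "v \<in> {x, y}" "w \<in> {x, y}" | "v \<in> {x, y}" "w \<in> ?W" | "v \<in> ?W" "w \<in> {x, y}"
      | "v \<in> ?W" "w \<in> ?W"
      by blast
    then show "v = w"
      by cases (use eq p1[of v] p1[of w] p2[of v] p2[of w] c(1)[of v] c(1)[of w] c(2)[of v w] h_eq[of v w]
        in simp_all)
  qed
  have \<gamma>: "\<gamma> {s, v} = linepath (p s) (p v)" if "s \<in> {x, y}" "v \<in> ?W" for s v
  proof -
    have "{s, v} \<inter> {x, y} = {s}" "{s, v} - {x, y} = {v}"
      using that by auto
    then show ?thesis by (simp add: \<gamma>_def)
  qed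
  have seg: "z \<in> path_image (\<gamma> {s, v}) \<longleftrightarrow>
      (\<exists>t. 0 \<le> t \<and> t \<le> 1 \<and> Re z = t * real (h v) \<and> Im z = (1 - t) * c s)"
    if "s \<in> {x, y}" "v \<in> ?W" for s v z
    using that by (simp add: \<gamma> p1 p2 in_segment_from_imaginary_axis)
  have ends: "p s \<in> path_image (\<gamma> {s, v})" "p v \<in> path_image (\<gamma> {s, v})"
    if "s \<in> {x, y}" "v \<in> ?W" for s v
    using that by (simp_all add: \<gamma>)
  have on_vertex: "w \<in> {s, v}" if sv: "s \<in> {x, y}" "v \<in> ?W" and w: "w \<in> verts G"
    and z: "p w \<in> path_image (\<gamma> {s, v})" for s v w
  proof -
    obtain t where t: "0 \<le> t" "t \<le> 1" "Re (p w) = t * real (h v)" "Im (p w) = (1 - t) * c s"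
      using z unfolding seg[OF sv] by blast
    show ?thesis
    proof (cases "w \<in> {x, y}")
      case True
      then have "c w = (1 - t) * c s"
        using t(4) p1 by simp
      then have "c w = c s"
        using t(1,2) by (auto simp: c_def split: if_splits)
      then show ?thesis using c(2)[OF True sv(1)] by simp
    next
      case False
      then have W: "w \<in> ?W" using w by blast
      then have "t = 1"
        using t(4) p2[OF W] c(1)[of s] by simp
      then have "h w = h v"
        using t(3) p2[OF W] by simp
      then show ?thesis using h_eq[OF W sv(2)] by simp
    qed
  qed
  have meet: "z \<in> p ` ({s, v} \<inter> {s', v'})"
    if sv: "s \<in> {x, y}" "v \<in> ?W" "s' \<in> {x, y}" "v' \<in> ?W" and ne: "{s, v} \<noteq> {s', v'}"
      and z: "z \<in> path_image (\<gamma> {s, v})" "z \<in> path_image (\<gamma> {s', v'})" for s v s' v' z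
  proof -
    obtain t where t: "0 \<le> t" "t \<le> 1" "Re z = t * real (h v)" "Im z = (1 - t) * c s"
      using z(1) unfolding seg[OF sv(1,2)] by blast
    obtain t' where t': "0 \<le> t'" "t' \<le> 1" "Re z = t' * real (h v')" "Im z = (1 - t') * c s'"
      using z(2) unfolding seg[OF sv(3,4)] by blast
    show ?thesis
    proof (cases "s = s'")
      case True
      \<comment> \<open>Equal imaginary parts give equal parameters, and different feet on the real
        axis then force \<open>t = 0\<close>.\<close>
      then have "t = t'" "v \<noteq> v'"
        using t(4) t'(4) c(1)[of s'] ne by auto
      then have "t = 0"
        using t(3) t'(3) h_eq[OF sv(2,4)] by auto
      then have "z = p s"
        using t(3,4) p1[OF sv(1)] by (simp add: complex_eq_iff)
      then show ?thesis using True by simp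
    next
      case False
      then have "c s' = - c s"
        using sv(1,3) xy(3) by (auto simp: c_def)
      \<comment> \<open>The imaginary parts agree but have opposite signs, so both vanish and the
        common point lies on the real axis.\<close>
      then have "(1 - t) + (1 - t') = 0"
        using t(4) t'(4) c(1)[of s] by (metis (no_types, opaque_lifting) add.commute add_cancel_right_left
            add_eq_0_iff mult_cancel_right mult_minus_left mult_minus_right)
      then have "t = 1" "t' = 1"
        using t(2) t'(2) by linarith+
      then have "h v = h v'" "z = p v"
        using t t' p2[OF sv(2)] by (auto simp: complex_eq_iff)
      then show ?thesis
        using h_eq[OF sv(2,4)] by simp
    qed
  qed
  have "plane_drawing G p \<gamma>"
    unfolding plane_drawing_def
  proof (intro conjI ballI impI)
    fix e assume "e \<in> edges G"
    then obtain s v where sv: "s \<in> {x, y}" "v \<in> ?W" and e: "e = {s, v}"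
      unfolding E by blast
    have V: "s \<in> verts G" "v \<in> verts G" "s \<noteq> v"
      using sv xy by auto
    then have "p s \<noteq> p v"
      using inj by (auto simp: inj_on_def)
    then show "arc (\<gamma> e)" "{pathstart (\<gamma> e), pathfinish (\<gamma> e)} = p ` e"
      unfolding e \<gamma>[OF sv] by auto
    show "path_image (\<gamma> e) \<inter> p ` verts G = p ` e"
      unfolding e using on_vertex[OF sv] ends[OF sv] V by auto
    fix e' assume "e' \<in> edges G" "e \<noteq> e'"
    then obtain s' v' where "s' \<in> {x, y}" "v' \<in> ?W" "e' = {s', v'}"
      unfolding E by blast
    then show "path_image (\<gamma> e) \<inter> path_image (\<gamma> e') \<subseteq> p ` (e \<inter> e')"
      using meet[OF sv] \<open>e \<noteq> e'\<close> unfolding e by blast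
  qed (fact inj)
  then show ?thesis
    unfolding planar_def by blast
qed

section \<open>The extremal value and the unique extremal graph\<close>

text \<open>Planarity enters through \<open>theta_separation\<close> alone. The equality case
  carries over because dominating pairs and double stars coincide in a simple triangle-free graph
  with a vertex outside the pair.\<close>

lemma c4_copies_bound:
  fixes G :: "'a ugraph"
  assumes G: "G \<in> planar_free_graphs n (cycle_graph 3)" and n: "4 \<le> n"
  shows "num_copies (cycle_graph 4) G \<le> (n - 2) choose 2"
    and "num_copies (cycle_graph 4) G = (n - 2) choose 2 \<longleftrightarrow> (\<exists>x y. double_star G x y)"
proof -
  have simple: "simple_graph G" and card: "card (verts G) = n"
    and pl: "planar G" and free: "triangle_free_edges (edges G)"
    using G free_of_triangle_iff[of G] by (auto simp: planar_free_graphs_def)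
  have fin: "finite (verts G)" using simple by (simp add: simple_graph_def)
  interpret triangle_free_edges "edges G" by (fact free)
  have sep: "theta_separation (verts G) (edges G)"
    using pl plane_drawing_theta_separation simple unfolding planar_def by blast
  note num = num_copies_c4[OF simple refl]
  note bound = card_c4_sets_bound[OF fin _ sep, unfolded card, OF n]
  show "num_copies (cycle_graph 4) G \<le> (n - 2) choose 2"
    using bound num by simp
  have ne: "verts G - {x, y} \<noteq> {}" for x y
  proof
    assume "verts G - {x, y} = {}"
    then have "card (verts G) \<le> card {x, y}"
      by (intro card_mono) auto
    also have "\<dots> \<le> 2" by (simp add: card_insert_if)
    finally show False using card n by simp
  qed
  have "dominating_pair (verts G) x y \<longleftrightarrow> double_star G x y" for x y
  proof
    assume dom: "dominating_pair (verts G) x y"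
    have "edges G = {{s, v} | s v. s \<in> {x, y} \<and> v \<in> verts G - {x, y}}"
    proof (intro equalityI subsetI)
      fix e assume e: "e \<in> edges G"
      then have "e \<subseteq> verts G" "card e = 2"
        using simple by (auto simp: simple_graph_def)
      then obtain u v where uv: "e = {u, v}" "u \<in> verts G" "v \<in> verts G"
        by (auto simp: card_2_iff)
      then have "(u \<in> {x, y}) \<noteq> (v \<in> {x, y})"
        using dominating_pair_adj[OF dom ne uv(2,3)] e by (simp add: adj_def)
      then have "u \<in> {x, y} \<and> v \<in> verts G - {x, y} \<or> v \<in> {x, y} \<and> u \<in> verts G - {x, y}"
        using uv by blast
      moreover have "e = {v, u}" using uv(1) by blast
      ultimately show "e \<in> {{s, v} | s v. s \<in> {x, y} \<and> v \<in> verts G - {x, y}}"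
        using uv(1) by blast
    next
      fix e assume "e \<in> {{s, v} | s v. s \<in> {x, y} \<and> v \<in> verts G - {x, y}}"
      then show "e \<in> edges G"
        using dom by (auto simp: dominating_pair_def adj_def)
    qed
    then show "double_star G x y"
      using dom unfolding dominating_pair_def double_star_def by blast
  next
    assume "double_star G x y"
    then show "dominating_pair (verts G) x y"
      unfolding double_star_def dominating_pair_def adj_def by blast
  qed
  moreover have "(\<exists>x y. dominating_pair (verts G) x y) \<longleftrightarrow>
      card (c4_sets (verts G)) = (n - 2) choose 2"
    using bound card_c4_sets_dominating_pair[OF _ fin ne] card by metis
  ultimately show "num_copies (cycle_graph 4) G = (n - 2) choose 2 \<longleftrightarrow> (\<exists>x y. double_star G x y)"
    using num by simp
qed

lemma double_star_planar_free:
  assumes "simple_graph G" "card (verts G) = n" "double_star G x y"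
  shows "G \<in> planar_free_graphs n (cycle_graph 3)"
  using assms double_star_planar[OF assms(3)] double_star_triangle_free[OF assms(3)]
    free_of_triangle_iff[OF assms(1)]
  by (auto simp: planar_free_graphs_def simple_graph_def)

theorem theorem2:
  fixes n :: nat
  assumes "n \<ge> 4"
  shows "ex_planar n (cycle_graph 4) (cycle_graph 3) = (n - 2) choose 2 \<and>
    (\<forall>G :: 'a ugraph.
       G \<in> planar_free_graphs n (cycle_graph 3) \<and>
         num_copies (cycle_graph 4) G = (n - 2) choose 2
       \<longleftrightarrow> simple_graph G \<and> isomorphic G (complete_bipartite 2 (n - 2)))"
proof
  \<comment> \<open>Stated for a fresh vertex type, since it is used at \<open>nat\<close> for the
    extremal value and at \<open>'a\<close> for uniqueness.\<close>
  have char: "G \<in> planar_free_graphs n (cycle_graph 3) \<and>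
      num_copies (cycle_graph 4) G = (n - 2) choose 2
    \<longleftrightarrow> simple_graph G \<and> isomorphic G (complete_bipartite 2 (n - 2))" for G :: "'b ugraph"
  proof
    assume G: "G \<in> planar_free_graphs n (cycle_graph 3) \<and>
      num_copies (cycle_graph 4) G = (n - 2) choose 2"
    then have "simple_graph G" "card (verts G) = n"
      by (auto simp: planar_free_graphs_def)
    moreover have "\<exists>x y. double_star G x y"
      using c4_copies_bound(2)[of G n] G assms by simp
    ultimately show "simple_graph G \<and> isomorphic G (complete_bipartite 2 (n - 2))"
      using isomorphic_complete_bipartite_2_iff[of G n] assms by auto
  next
    assume G: "simple_graph G \<and> isomorphic G (complete_bipartite 2 (n - 2))"
    then obtain x y where st: "card (verts G) = n" "double_star G x y"
      using isomorphic_complete_bipartite_2_iff[of G n] assms by auto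
    have P: "G \<in> planar_free_graphs n (cycle_graph 3)"
      using double_star_planar_free[OF _ st] G by simp
    then show "G \<in> planar_free_graphs n (cycle_graph 3) \<and>
        num_copies (cycle_graph 4) G = (n - 2) choose 2"
      using c4_copies_bound(2)[OF P assms] st by blast
  qed
  let ?K = "complete_bipartite 2 (n - 2)" and ?M = "(n - 2) choose 2"
  let ?P = "planar_free_graphs n (cycle_graph 3) :: nat ugraph set"
  have "simple_graph ?K"
    by (auto simp: simple_graph_def complete_bipartite_def)
  moreover have "isomorphic ?K ?K"
    unfolding isomorphic_def by (intro exI[of _ id]) auto
  ultimately have K: "?K \<in> ?P" "num_copies (cycle_graph 4) ?K = ?M"
    using char[of ?K] by auto
  have bound: "num_copies (cycle_graph 4) G \<le> ?M" if "G \<in> ?P" for G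
    using c4_copies_bound(1)[OF that assms] .
  show "ex_planar n (cycle_graph 4) (cycle_graph 3) = ?M"
    unfolding ex_planar_def
  proof (rule Max_eqI)
    \<comment> \<open>The upper bound itself makes the set of values finite, so that
      \<open>Max\<close> is meaningful.\<close>
    show "finite (num_copies (cycle_graph 4) ` ?P)"
      by (rule finite_subset[of _ "{..?M}"]) (use bound in auto)
    show "?M \<in> num_copies (cycle_graph 4) ` ?P"
      using K by (metis imageI)
  qed (use bound in auto)
  show "\<forall>G :: 'a ugraph.
       G \<in> planar_free_graphs n (cycle_graph 3) \<and>
         num_copies (cycle_graph 4) G = (n - 2) choose 2
       \<longleftrightarrow> simple_graph G \<and> isomorphic G (complete_bipartite 2 (n - 2))"
    using char by blast
qed

end
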